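(* Let $\boldsymbol{d}=(d_0,\dots,d_n)\in(\mathbb{N}_{>0})^{n+1}$, and let $\Psi_{\boldsymbol{d}}\colon\bigoplus_{i=0}^nT_i\to T$, $\mathcal{M}_{\boldsymbol{d}}$ and $\mathcal{N}_{\boldsymbol{d}}$ be the Macaulay map, matrix and distinguished principal submatrix for the degree $m=|\boldsymbol{d}|-n$. Let $M=\mathbb{Z}^n$, $\mathcal{A}_i=\{\boldsymbol{a}\in\mathbb{N}^n\mid|\boldsymbol{a}|\le d_i\}$ and $\Delta_i=\operatorname{conv}(\mathcal{A}_i)$ for $i=0,\dots,n$, $\boldsymbol{\mathcal{A}}=(\mathcal{A}_0,\dots,\mathcal{A}_n)$, and let $\varphi_i\colon\Delta_i\to\mathbb{R}$ be given by $\varphi_0(\boldsymbol{x})=|\boldsymbol{x}|$ and $\varphi_i(\boldsymbol{x})=d_i-x_i$ for $i>0$, with inf-convolution $\varphi=\boxplus_i\varphi_i$. For $i=0,\dots,n$ let $\mu_i\colon\mathbb{R}^n\to\mathbb{R}$ be a linear function and $\rho_i=\varphi_i+\mu_i$, set $\boldsymbol{\rho}=(\rho_0,\dots,\rho_n)$ and $\rho=\boxplus_i\rho_i$, and suppose that the mixed subdivision $S(\rho)$ of $\Delta=\sum_i\Delta_i$ is tight and $S(\rho)\succeq S(\varphi)$. Let $\boldsymbol{\delta}=(\delta_1,\dots,\delta_n)\in\mathbb{R}^n$ with $\delta_i+1>0$ for all $i$ and $\sum_{i=1}^n(\delta_i+1)<1$, generic with respect to $S(\rho)$, and let $\Phi_{\boldsymbol{\mathcal{A}},\boldsymbol{\rho}}\colon\bigoplus_{i=0}^nV_i\to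 V$, $\mathcal{H}_{\boldsymbol{\mathcal{A}},\boldsymbol{\rho}}$ and $\mathcal{E}_{\boldsymbol{\mathcal{A}},\boldsymbol{\rho}}$ be the Sylvester map, Canny-Emiris matrix and distinguished principal submatrix associated to $\boldsymbol{\mathcal{A}}$, $\boldsymbol{\rho}$ and $\boldsymbol{\delta}$. Then the morphism of algebras $\pi_*\colon\mathbb{K}[\boldsymbol{t}]=\mathbb{K}[t_0,\dots,t_n]\to\mathbb{K}[\boldsymbol{s}]=\mathbb{K}[s_1,\dots,s_n]$ defined by $\pi_*(t_0)=1$ and $\pi_*(t_i)=s_i$, $i=1,\dots,n$, induces maps $\pi_*\colon\bigoplus_iT_i\to\bigoplus_iV_i$ (componentwise) and $\pi_*\colon T\to V$ making a commutative diagram, that is, $$\pi_*\circ\Psi_{\boldsymbol{d}}=\Phi_{\boldsymbol{\mathcal{A}},\boldsymbol{\rho}}\circ\pi_*,$$ and bijections between the monomial bases of $\bigoplus_{i=0}^nT_i$ and $\bigoplus_{i=0}^nV_i$, and between those of $T$ and $V$. In particular $\mathcal{H}_{\boldsymbol{\mathcal{A}},\boldsymbol{\rho}}=\mathcal{M}_{\boldsymbol{d}}$ and $\mathcal{E}_{\boldsymbol{\mathcal{A}},\boldsymbol{\rho}}=\mathcal{N}_{\boldsymbol{d}}$ (identifying the index sets through these bijections).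
   Context: For vectors $\boldsymbol{x}$ of $\mathbb{R}^n$ or $\mathbb{R}^{n+1}$, $|\boldsymbol{x}|$ denotes the sum of the coordinates. Macaulay data. For $i=0,\dots,n$ let $\boldsymbol{u}_i=\{u_{i,\boldsymbol{c}}\}$ be variables indexed by the $\boldsymbol{c}\in\mathbb{N}^{n+1}$ with $|\boldsymbol{c}|=d_i$, $\boldsymbol{u}=(\boldsymbol{u}_0,\dots,\boldsymbol{u}_n)$, $\mathbb{K}=\mathbb{C}(\boldsymbol{u})$ and $P_i=\sum_{|\boldsymbol{c}|=d_i}u_{i,\boldsymbol{c}}\boldsymbol{t}^{\boldsymbol{c}}\in\mathbb{K}[t_0,\dots,t_n]$. With $m=|\boldsymbol{d}|-n$, let $T_i=\{Q\in\mathbb{K}[\boldsymbol{t}]_{m-d_i}\mid\deg_{t_j}(Q)<d_j\text{ for }j=i+1,\dots,n\}$, $T=\mathbb{K}[\boldsymbol{t}]_m$ (homogeneous parts) and $\Psi_{\boldsymbol{d}}(Q_0,\dots,Q_n)=\sum_iQ_iP_i$. Let $\mathcal{I}=\{\boldsymbol{c}\in\mathbb{N}^{n+1}\mid|\boldsymbol{c}|=m\}$, and $\mathcal{I}_i=\{\boldsymbol{c}\in\mathcal{I}\mid c_i\ge d_i,\ c_j<d_j\text{ for }j>i\}$, which form a partition of $\mathcal{I}$. With $\widehat e_0,\dots,\widehat e_n$ the standard basis of $\mathbb{R}^{n+1}$, the monomial basis of $T_i$ is $\{\boldsymbol{t}^{\boldsymbol{c}-d_i\widehat e_i}\}_{\boldsymbol{c}\in\mathcal{I}_i}$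 and that of $T$ is $\{\boldsymbol{t}^{\boldsymbol{c}}\}_{\boldsymbol{c}\in\mathcal{I}}$. $\mathcal{M}_{\boldsymbol{d}}\in\mathbb{K}^{\mathcal{I}\times\mathcal{I}}$ is the matrix of $\Psi_{\boldsymbol{d}}$ in terms of row vectors with respect to these bases. Let $\mathcal{I}^\circ$ be the complement in $\mathcal{I}$ of the set of $\boldsymbol{c}$ having a unique $i$ with $c_i\ge d_i$; $\mathcal{N}_{\boldsymbol{d}}$ is the principal submatrix of $\mathcal{M}_{\boldsymbol{d}}$ indexed by $\mathcal{I}^\circ$. Polyhedral notation. For a convex piecewise affine function $\rho\colon\Delta\to\mathbb{R}$ on a polytope of $\mathbb{R}^n$ and $v\in\mathbb{R}^n$ put $\Gamma(\rho,v)=\{x\in\Delta\mid\rho(x)+\langle v,x\rangle=\min_{y\in\Delta}(\rho(y)+\langle v,y\rangle)\}$; $S(\rho)$ is the collection of all these sets, called cells, and an $n$-cell is a cell of dimension $n$. The inf-convolution of $\rho_i\colon\Delta_i\to\mathbb{R}$ is $(\boxplus_i\rho_i)(x)=\inf\{\sum_i\rho_i(x_i)\mid x_i\in\Delta_i,\sum_ix_i=x\}$ on $\Delta=\sum_i\Delta_i$, and $S(\boxplus_i\rho_i)$ is called a mixed subdivision of $\Delta$. The $i$-th component of a cell $C$ of $S(\rho)$, $\rho=\boxplus_i\rho_i$, is the set $C_i$ of $x_i\in\Delta_i$ for which there are $x_j\in\Delta_j$, $j\ne i$, with $\sum_jx_j\in C$ and $\rho(\sum_jx_j)=\sum_j\rho_j(x_j)$;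 if $C=\Gamma(\rho,v)$ then $C_i=\Gamma(\rho_i,v)$. $S(\rho)$ is tight if $\sum_i\dim(C_i)=n$ for every $n$-cell $C$; then $C$ is $k$-mixed if $C_i$ is a segment for all $i\ne k$. $S(\rho)\succeq S(\varphi)$ means that for every $C\in S(\rho)$ there is $D\in S(\varphi)$ with $C\subset D$ and $C_i\subset D_i$ for all $i$. Genericity of $\boldsymbol{\delta}$: no point of $\mathbb{Z}^n$ lies in $B+\boldsymbol{\delta}$ for a cell $B$ of $S(\rho)$ of dimension at most $n-1$. Canny-Emiris data. The variable $u_{i,\boldsymbol{a}}$ for $\boldsymbol{a}=(a_1,\dots,a_n)\in\mathcal{A}_i$ is identified with $u_{i,\boldsymbol{c}}$ for $\boldsymbol{c}=(d_i-|\boldsymbol{a}|,a_1,\dots,a_n)$. Set $F_i=\sum_{\boldsymbol{a}\in\mathcal{A}_i}u_{i,\boldsymbol{a}}\boldsymbol{s}^{\boldsymbol{a}}$. Let $\mathcal{B}=(\Delta+\boldsymbol{\delta})\cap\mathbb{Z}^n$. Each $b\in\mathcal{B}$ lies in $C+\boldsymbol{\delta}$ for a unique $n$-cell $C$ of $S(\rho)$; let $i(b)$ be the largest $i$ with $\dim(C_i)=0$ and $a(b)\in\mathcal{A}_{i(b)}$ the unique point of $C_{i(b)}$; $\mathcal{B}_i=\{b\in\mathcal{B}\mid i(b)=i\}$. Let $V_i=\sum_{b\in\mathcal{B}_i}\mathbb{K}\,\boldsymbol{s}^{b-a(b)}$ and $V=\sum_{b\in\mathcal{B}}\mathbb{K}\,\boldsymbol{s}^b$,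 as subspaces of $\mathbb{K}[s_1^{\pm1},\dots,s_n^{\pm1}]$, with the monomial bases given by these generators (indexed by $\mathcal{B}_i$ and $\mathcal{B}$ respectively), and $\Phi_{\boldsymbol{\mathcal{A}},\boldsymbol{\rho}}(G_0,\dots,G_n)=\sum_iG_iF_i$. $\mathcal{H}_{\boldsymbol{\mathcal{A}},\boldsymbol{\rho}}\in\mathbb{K}^{\mathcal{B}\times\mathcal{B}}$ is the matrix of this map in terms of row vectors with respect to these bases. $\mathcal{B}^\circ\subset\mathcal{B}$ is the set of elements lying in $C+\boldsymbol{\delta}$ for an $n$-cell $C$ of $S(\rho)$ that is not $i$-mixed for any $i$, and $\mathcal{E}_{\boldsymbol{\mathcal{A}},\boldsymbol{\rho}}$ is the principal submatrix of $\mathcal{H}_{\boldsymbol{\mathcal{A}},\boldsymbol{\rho}}$ indexed by $\mathcal{B}^\circ$. *)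

theory Defs
  imports
    "HOL-Analysis.Analysis"
    "HOL-Library.Poly_Mapping"
    "HOL-Library.Countable"
    "HOL-Computational_Algebra.Fraction_Field"
begin

section \<open>Indices and vectors\<close>

text \<open>The index set \<open>{0, ..., n}\<close> is a finite linearly ordered type \<open>'i\<close>, so that
  \<open>n = CARD('i) - 1\<close> and every \<open>n \<ge> 0\<close> occurs; its least element plays the role of \<open>0\<close>.
  Vectors with coordinates \<open>0, ..., n\<close> are elements of \<open>_ ^ 'i\<close>, and a space of vectors with
  coordinates \<open>1, ..., n\<close> (such as \<open>\<real>\<^sup>n\<close> or \<open>\<int>\<^sup>n\<close>) is the set of elements
  of \<open>_ ^ 'i\<close> whose coordinate at the least index vanishes.\<close>

type_synonym 'i nvec = "(nat, 'i) vec"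
type_synonym 'i zvec = "(int, 'i) vec"
type_synonym 'i rvec = "(real, 'i) vec"

definition ix0 :: "'i::{finite,linorder}" where
  "ix0 = Min UNIV"

definition ndim :: "'i itself \<Rightarrow> nat" where
  "ndim _ = CARD('i) - 1"

definition coords1n :: "('a::zero ^ 'i::{finite,linorder}) set" where
  "coords1n = {x. x $ ix0 = 0}"

definition vsum :: "'a::comm_monoid_add ^ 'i::finite \<Rightarrow> 'a" where
  "vsum x = (\<Sum>i\<in>UNIV. x $ i)"

definition rvec_of :: "'i::finite zvec \<Rightarrow> 'i rvec" where
  "rvec_of a = (\<chi> i. real_of_int (a $ i))"

section \<open>Matrices\<close>

text \<open>The matrix, in terms of row vectors, of a map \<open>f\<close> with respect to the basis \<open>e\<close> of its
  source and the monomial basis of its target, both indexed by \<open>X\<close>: row \<open>x\<close> lists the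
  coefficients of \<open>f (e x)\<close>.\<close>

definition row_matrix ::
  "'x set \<Rightarrow> ('x \<Rightarrow> 'v) \<Rightarrow> ('v \<Rightarrow> ('x \<Rightarrow>\<^sub>0 'k::zero)) \<Rightarrow> 'x \<Rightarrow> 'x \<Rightarrow> 'k" where
  "row_matrix X e f = (\<lambda>x\<in>X. \<lambda>y\<in>X. Poly_Mapping.lookup (f (e x)) y)"

definition principal_submatrix :: "('x \<Rightarrow> 'x \<Rightarrow> 'k) \<Rightarrow> 'x set \<Rightarrow> 'x \<Rightarrow> 'x \<Rightarrow> 'k" where
  "principal_submatrix A Y = (\<lambda>x\<in>Y. \<lambda>y\<in>Y. A x y)"

definition direct_sum :: "('i \<Rightarrow> 'v set) \<Rightarrow> ('i \<Rightarrow> 'v) set" where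
  "direct_sum W = {Q. \<forall>i. Q i \<in> W i}"

definition in_summand :: "'i \<Rightarrow> 'v \<Rightarrow> 'i \<Rightarrow> 'v::zero" where
  "in_summand i g = (\<lambda>j. if j = i then g else 0)"

section \<open>The field of coefficients\<close>

text \<open>Polynomials over \<open>\<complex>\<close> in countably many variables, numbered by \<open>nat\<close>; the variable
  \<open>u\<^bsub>i,c\<^esub>\<close> is the one numbered \<open>to_nat (i, c)\<close> (\<open>to_nat\<close> is injective).
  The field \<open>K = \<complex>(u)\<close>, which only involves the \<open>u\<^bsub>i,c\<^esub>\<close> with \<open>|c| = d\<^sub>i\<close>,
  is the subfield \<open>Kfield d\<close> of the fraction field of this polynomial ring.\<close>

type_synonym upoly = "(nat \<Rightarrow>\<^sub>0 nat) \<Rightarrow>\<^sub>0 complex"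
type_synonym ufrac = "upoly fract"

definition upoly_vars :: "upoly \<Rightarrow> nat set" where
  "upoly_vars p = (\<Union>e\<in>Poly_Mapping.keys p. Poly_Mapping.keys e)"

definition u_index :: "'i::finite \<Rightarrow> 'i nvec \<Rightarrow> nat" where
  "u_index i c = to_nat (i, c)"

definition uvar :: "'i::finite \<Rightarrow> 'i nvec \<Rightarrow> ufrac" where
  "uvar i c = Fract (Poly_Mapping.single (Poly_Mapping.single (u_index i c) 1) 1) 1"

definition Kfield :: "'i::finite nvec \<Rightarrow> ufrac set" where
  "Kfield d = (let U = {u_index i c | i c. vsum c = d $ i} in
     {Fract p q | p q. q \<noteq> 0 \<and> upoly_vars p \<subseteq> U \<and> upoly_vars q \<subseteq> U})"

section \<open>Macaulay data\<close>

type_synonym 'i tpoly = "('i nvec) \<Rightarrow>\<^sub>0 ufrac"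

definition mac_P :: "'i::finite nvec \<Rightarrow> 'i \<Rightarrow> 'i tpoly" where
  "mac_P d i = (\<Sum>c\<in>{c. vsum c = d $ i}. Poly_Mapping.single c (uvar i c))"

definition mac_deg :: "'i::finite nvec \<Rightarrow> nat" where
  "mac_deg d = vsum d - ndim TYPE('i)"

definition homog_part :: "'i::finite nvec \<Rightarrow> nat \<Rightarrow> 'i tpoly set" where
  "homog_part d e = {Q. (\<forall>c. Poly_Mapping.lookup Q c \<in> Kfield d) \<and>
                        (\<forall>c\<in>Poly_Mapping.keys Q. vsum c = e)}"

definition deg_in :: "'i::finite \<Rightarrow> 'i tpoly \<Rightarrow> nat" where
  "deg_in j Q = Max (insert 0 ((\<lambda>c. c $ j) ` Poly_Mapping.keys Q))"

definition mac_T :: "'i::{finite,linorder} nvec \<Rightarrow> 'i tpoly set" where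
  "mac_T d = homog_part d (mac_deg d)"

definition mac_Ti :: "'i::{finite,linorder} nvec \<Rightarrow> 'i \<Rightarrow> 'i tpoly set" where
  "mac_Ti d i = {Q \<in> homog_part d (mac_deg d - d $ i). \<forall>j>i. deg_in j Q < d $ j}"

definition mac_Psi :: "'i::finite nvec \<Rightarrow> ('i \<Rightarrow> 'i tpoly) \<Rightarrow> 'i tpoly" where
  "mac_Psi d Q = (\<Sum>i\<in>UNIV. Q i * mac_P d i)"

definition mac_I :: "'i::finite nvec \<Rightarrow> 'i nvec set" where
  "mac_I d = {c. vsum c = mac_deg d}"

definition mac_Ii :: "'i::{finite,linorder} nvec \<Rightarrow> 'i \<Rightarrow> 'i nvec set" where
  "mac_Ii d i = {c \<in> mac_I d. d $ i \<le> c $ i \<and> (\<forall>j>i. c $ j < d $ j)}"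

definition mac_Icirc :: "'i::finite nvec \<Rightarrow> 'i nvec set" where
  "mac_Icirc d = mac_I d - {c. \<exists>!i. d $ i \<le> c $ i}"

definition mac_index :: "'i::{finite,linorder} nvec \<Rightarrow> 'i nvec \<Rightarrow> 'i" where
  "mac_index d c = (THE i. c \<in> mac_Ii d i)"

definition mac_target_basis :: "'i::finite nvec \<Rightarrow> 'i tpoly" where
  "mac_target_basis c = Poly_Mapping.single c 1"

definition mac_source_basis ::
  "'i::{finite,linorder} nvec \<Rightarrow> 'i nvec \<Rightarrow> 'i \<Rightarrow> 'i tpoly" where
  "mac_source_basis d c =
     (let i = mac_index d c in in_summand i (Poly_Mapping.single (c - axis i (d $ i)) 1))"

definition mac_M :: "'i::{finite,linorder} nvec \<Rightarrow> 'i nvec \<Rightarrow> 'i nvec \<Rightarrow> ufrac" where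
  "mac_M d = row_matrix (mac_I d) (mac_source_basis d) (mac_Psi d)"

definition mac_N :: "'i::{finite,linorder} nvec \<Rightarrow> 'i nvec \<Rightarrow> 'i nvec \<Rightarrow> ufrac" where
  "mac_N d = principal_submatrix (mac_M d) (mac_Icirc d)"

section \<open>Mixed subdivisions\<close>

text \<open>A function on a polytope is given by the polytope and a total function whose values
  outside the polytope are irrelevant.\<close>

definition cell ::
  "'i rvec set \<Rightarrow> ('i rvec \<Rightarrow> real) \<Rightarrow> 'i rvec \<Rightarrow> 'i::finite rvec set" where
  "cell D r v = {x \<in> D. \<forall>y\<in>D. r x + v \<bullet> x \<le> r y + v \<bullet> y}"

definition cells ::
  "'i rvec set \<Rightarrow> ('i rvec \<Rightarrow> real) \<Rightarrow> 'i::{finite,linorder} rvec set set" where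
  "cells D r = cell D r ` coords1n"

definition mink_sum :: "('i \<Rightarrow> 'i rvec set) \<Rightarrow> 'i::finite rvec set" where
  "mink_sum D = {\<Sum>i\<in>UNIV. x i | x. \<forall>i. x i \<in> D i}"

definition inf_conv ::
  "('i \<Rightarrow> 'i rvec set) \<Rightarrow> ('i \<Rightarrow> 'i rvec \<Rightarrow> real) \<Rightarrow> 'i::finite rvec \<Rightarrow> real" where
  "inf_conv D r x = Inf {\<Sum>i\<in>UNIV. r i (y i) | y. (\<forall>i. y i \<in> D i) \<and> (\<Sum>i\<in>UNIV. y i) = x}"

definition mixed_subdiv ::
  "('i \<Rightarrow> 'i rvec set) \<Rightarrow> ('i \<Rightarrow> 'i rvec \<Rightarrow> real) \<Rightarrow>
   'i::{finite,linorder} rvec set set" where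
  "mixed_subdiv D r = cells (mink_sum D) (inf_conv D r)"

definition ncells ::
  "('i \<Rightarrow> 'i rvec set) \<Rightarrow> ('i \<Rightarrow> 'i rvec \<Rightarrow> real) \<Rightarrow>
   'i::{finite,linorder} rvec set set" where
  "ncells D r = {C \<in> mixed_subdiv D r. aff_dim C = int (ndim TYPE('i))}"

definition component ::
  "('i \<Rightarrow> 'i rvec set) \<Rightarrow> ('i \<Rightarrow> 'i rvec \<Rightarrow> real) \<Rightarrow>
   'i::finite rvec set \<Rightarrow> 'i \<Rightarrow> 'i rvec set" where
  "component D r C i = {x i | x. (\<forall>j. x j \<in> D j) \<and> (\<Sum>j\<in>UNIV. x j) \<in> C \<and>
     inf_conv D r (\<Sum>j\<in>UNIV. x j) = (\<Sum>j\<in>UNIV. r j (x j))}"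

definition tight_subdiv ::
  "('i \<Rightarrow> 'i rvec set) \<Rightarrow> ('i \<Rightarrow> 'i::{finite,linorder} rvec \<Rightarrow> real) \<Rightarrow> bool" where
  "tight_subdiv D r \<longleftrightarrow>
     (\<forall>C\<in>ncells D r. (\<Sum>i\<in>UNIV. aff_dim (component D r C i)) = int (ndim TYPE('i)))"

definition is_segment :: "'i::finite rvec set \<Rightarrow> bool" where
  "is_segment S \<longleftrightarrow> (\<exists>a b. a \<noteq> b \<and> S = closed_segment a b)"

definition mixed_cell ::
  "('i \<Rightarrow> 'i rvec set) \<Rightarrow> ('i \<Rightarrow> 'i rvec \<Rightarrow> real) \<Rightarrow> 'i \<Rightarrow>
   'i::finite rvec set \<Rightarrow> bool" where
  "mixed_cell D r k C \<longleftrightarrow> (\<forall>i. i \<noteq> k \<longrightarrow> is_segment (component D r C i))"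

definition subdiv_refines ::
  "('i \<Rightarrow> 'i rvec set) \<Rightarrow> ('i \<Rightarrow> 'i rvec \<Rightarrow> real) \<Rightarrow>
   ('i \<Rightarrow> 'i::{finite,linorder} rvec \<Rightarrow> real) \<Rightarrow> bool" where
  "subdiv_refines D r f \<longleftrightarrow> (\<forall>C\<in>mixed_subdiv D r. \<exists>E\<in>mixed_subdiv D f.
     C \<subseteq> E \<and> (\<forall>i. component D r C i \<subseteq> component D f E i))"

definition generic_shift ::
  "('i \<Rightarrow> 'i rvec set) \<Rightarrow> ('i \<Rightarrow> 'i rvec \<Rightarrow> real) \<Rightarrow>
   'i::{finite,linorder} rvec \<Rightarrow> bool" where
  "generic_shift D r \<delta> \<longleftrightarrow> (\<forall>B\<in>mixed_subdiv D r. aff_dim B \<le> int (ndim TYPE('i)) - 1 \<longrightarrow>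
     \<not> (\<exists>b\<in>coords1n. rvec_of b \<in> (+) \<delta> ` B))"

section \<open>Canny-Emiris data\<close>

text \<open>Laurent polynomials in \<open>s\<^sub>1, ..., s\<^sub>n\<close> are those whose exponents lie in
  \<open>coords1n\<close>.\<close>

type_synonym 'i spoly = "('i zvec) \<Rightarrow>\<^sub>0 ufrac"

definition ce_B ::
  "('i \<Rightarrow> 'i rvec set) \<Rightarrow> 'i rvec \<Rightarrow> 'i::{finite,linorder} zvec set" where
  "ce_B D \<delta> = {b \<in> coords1n. rvec_of b \<in> (+) \<delta> ` mink_sum D}"

text \<open>For a generic shift \<open>\<delta>\<close>, a tight subdivision and \<open>b \<in> ce_B D \<delta>\<close>, the \<open>n\<close>-cell containing \<open>b - \<delta>\<close>,
  the index \<open>i(b)\<close> and the point \<open>a(b)\<close>.\<close>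

definition ce_cell ::
  "('i \<Rightarrow> 'i rvec set) \<Rightarrow> ('i \<Rightarrow> 'i rvec \<Rightarrow> real) \<Rightarrow> 'i rvec \<Rightarrow>
   'i zvec \<Rightarrow> 'i::{finite,linorder} rvec set" where
  "ce_cell D r \<delta> b = (THE C. C \<in> ncells D r \<and> rvec_of b \<in> (+) \<delta> ` C)"

definition ce_index ::
  "('i \<Rightarrow> 'i rvec set) \<Rightarrow> ('i \<Rightarrow> 'i rvec \<Rightarrow> real) \<Rightarrow> 'i rvec \<Rightarrow>
   'i zvec \<Rightarrow> 'i::{finite,linorder}" where
  "ce_index D r \<delta> b = Max {i. aff_dim (component D r (ce_cell D r \<delta> b) i) = 0}"

definition ce_point ::
  "('i \<Rightarrow> 'i rvec set) \<Rightarrow> ('i \<Rightarrow> 'i rvec \<Rightarrow> real) \<Rightarrow> 'i rvec \<Rightarrow>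
   'i zvec \<Rightarrow> 'i::{finite,linorder} zvec" where
  "ce_point D r \<delta> b =
     (THE a. component D r (ce_cell D r \<delta> b) (ce_index D r \<delta> b) = {rvec_of a})"

definition ce_Bi ::
  "('i \<Rightarrow> 'i rvec set) \<Rightarrow> ('i \<Rightarrow> 'i rvec \<Rightarrow> real) \<Rightarrow> 'i rvec \<Rightarrow>
   'i \<Rightarrow> 'i::{finite,linorder} zvec set" where
  "ce_Bi D r \<delta> i = {b \<in> ce_B D \<delta>. ce_index D r \<delta> b = i}"

definition ce_Bcirc ::
  "('i \<Rightarrow> 'i rvec set) \<Rightarrow> ('i \<Rightarrow> 'i rvec \<Rightarrow> real) \<Rightarrow> 'i rvec \<Rightarrow>
   'i::{finite,linorder} zvec set" where
  "ce_Bcirc D r \<delta> = {b \<in> ce_B D \<delta>.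
     \<exists>C\<in>ncells D r. rvec_of b \<in> (+) \<delta> ` C \<and> (\<forall>i. \<not> mixed_cell D r i C)}"

definition mono_span :: "ufrac set \<Rightarrow> 'x set \<Rightarrow> ('x \<Rightarrow> 'i zvec) \<Rightarrow> 'i::finite spoly set" where
  "mono_span K X e = {\<Sum>x\<in>X. Poly_Mapping.single (e x) (k x) | k. \<forall>x\<in>X. k x \<in> K}"

definition ce_V ::
  "ufrac set \<Rightarrow> ('i \<Rightarrow> 'i rvec set) \<Rightarrow> 'i rvec \<Rightarrow> 'i::{finite,linorder} spoly set" where
  "ce_V K D \<delta> = mono_span K (ce_B D \<delta>) (\<lambda>b. b)"

definition ce_Vi ::
  "ufrac set \<Rightarrow> ('i \<Rightarrow> 'i rvec set) \<Rightarrow> ('i \<Rightarrow> 'i rvec \<Rightarrow> real) \<Rightarrow> 'i rvec \<Rightarrow>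
   'i \<Rightarrow> 'i::{finite,linorder} spoly set" where
  "ce_Vi K D r \<delta> i = mono_span K (ce_Bi D r \<delta> i) (\<lambda>b. b - ce_point D r \<delta> b)"

definition ce_target_basis :: "'i::finite zvec \<Rightarrow> 'i spoly" where
  "ce_target_basis b = Poly_Mapping.single b 1"

definition ce_source_basis ::
  "('i \<Rightarrow> 'i rvec set) \<Rightarrow> ('i \<Rightarrow> 'i rvec \<Rightarrow> real) \<Rightarrow> 'i rvec \<Rightarrow>
   'i zvec \<Rightarrow> 'i \<Rightarrow> 'i::{finite,linorder} spoly" where
  "ce_source_basis D r \<delta> b =
     in_summand (ce_index D r \<delta> b) (Poly_Mapping.single (b - ce_point D r \<delta> b) 1)"

definition ce_Phi :: "('i \<Rightarrow> 'i spoly) \<Rightarrow> ('i \<Rightarrow> 'i spoly) \<Rightarrow> 'i::finite spoly" where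
  "ce_Phi F G = (\<Sum>i\<in>UNIV. G i * F i)"

definition ce_H ::
  "('i \<Rightarrow> 'i spoly) \<Rightarrow> ('i \<Rightarrow> 'i rvec set) \<Rightarrow> ('i \<Rightarrow> 'i rvec \<Rightarrow> real) \<Rightarrow> 'i rvec \<Rightarrow>
   'i zvec \<Rightarrow> 'i::{finite,linorder} zvec \<Rightarrow> ufrac" where
  "ce_H F D r \<delta> = row_matrix (ce_B D \<delta>) (ce_source_basis D r \<delta>) (ce_Phi F)"

definition ce_E ::
  "('i \<Rightarrow> 'i spoly) \<Rightarrow> ('i \<Rightarrow> 'i rvec set) \<Rightarrow> ('i \<Rightarrow> 'i rvec \<Rightarrow> real) \<Rightarrow> 'i rvec \<Rightarrow>
   'i zvec \<Rightarrow> 'i::{finite,linorder} zvec \<Rightarrow> ufrac" where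
  "ce_E F D r \<delta> = principal_submatrix (ce_H F D r \<delta>) (ce_Bcirc D r \<delta>)"

section \<open>The supports and functions of the Macaulay case\<close>

definition supp_A :: "'i nvec \<Rightarrow> 'i \<Rightarrow> 'i::{finite,linorder} zvec set" where
  "supp_A d i = {a \<in> coords1n. (\<forall>j. 0 \<le> a $ j) \<and> vsum a \<le> int (d $ i)}"

definition polytope_D :: "'i nvec \<Rightarrow> 'i \<Rightarrow> 'i::{finite,linorder} rvec set" where
  "polytope_D d i = convex hull (rvec_of ` supp_A d i)"

text \<open>The coordinate at \<open>ix0\<close> vanishes on \<open>coords1n\<close>, so there \<open>vsum x\<close> is the sum of the
  coordinates \<open>1, ..., n\<close>.\<close>

definition phi :: "'i nvec \<Rightarrow> 'i \<Rightarrow> 'i::{finite,linorder} rvec \<Rightarrow> real" where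
  "phi d i x = (if i = ix0 then vsum x else real (d $ i) - x $ i)"

text \<open>The exponent \<open>(e - |a|, a\<^sub>1, ..., a\<^sub>n)\<close>.\<close>

definition homogenize :: "nat \<Rightarrow> 'i zvec \<Rightarrow> 'i::{finite,linorder} nvec" where
  "homogenize e a = (\<chi> j. if j = ix0 then e - nat (vsum a) else nat (a $ j))"

definition gen_F :: "'i nvec \<Rightarrow> 'i \<Rightarrow> 'i::{finite,linorder} spoly" where
  "gen_F d i =
     (\<Sum>a\<in>supp_A d i. Poly_Mapping.single a (uvar i (homogenize (d $ i) a)))"

section \<open>The dehomogenization morphism\<close>

text \<open>The substitution homomorphism with \<open>t\<^sub>0 \<mapsto> 1\<close> and \<open>t\<^sub>i \<mapsto> s\<^sub>i\<close>. The polynomial ring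
  \<open>K[s]\<close> is taken inside the Laurent polynomial ring, which contains \<open>V\<close>.\<close>

definition pi_var :: "'i \<Rightarrow> 'i::{finite,linorder} spoly" where
  "pi_var i = (if i = ix0 then 1 else Poly_Mapping.single (axis i 1) 1)"

definition pi_star :: "'i tpoly \<Rightarrow> 'i::{finite,linorder} spoly" where
  "pi_star Q = (\<Sum>c\<in>Poly_Mapping.keys Q.
     Poly_Mapping.single 0 (Poly_Mapping.lookup Q c) * (\<Prod>i\<in>UNIV. pi_var i ^ (c $ i)))"

definition pi_star_sum :: "('i \<Rightarrow> 'i tpoly) \<Rightarrow> 'i \<Rightarrow> 'i::{finite,linorder} spoly" where
  "pi_star_sum Q = (\<lambda>i. pi_star (Q i))"

lemma pi_star_superset:
  assumes "finite S" "Poly_Mapping.keys Q \<subseteq> S"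
  shows "pi_star Q = (\<Sum>c\<in>S. Poly_Mapping.single 0 (Poly_Mapping.lookup Q c) *
                              (\<Prod>i\<in>UNIV. pi_var i ^ (c $ i)))"
  unfolding pi_star_def using assms
  by (intro sum.mono_neutral_left) (auto simp: in_keys_iff)

lemma pi_star_add: "pi_star (P + Q) = pi_star P + pi_star Q"
proof -
  let ?S = "Poly_Mapping.keys P \<union> Poly_Mapping.keys Q"
  have "Poly_Mapping.keys (P + Q) \<subseteq> ?S"
    by (rule Poly_Mapping.keys_add)
  then show ?thesis
    by (simp add: pi_star_superset[of ?S] lookup_add single_add distrib_right sum.distrib)
qed

lemma pi_star_single:
  "pi_star (Poly_Mapping.single c k) =
     Poly_Mapping.single 0 k * (\<Prod>i\<in>UNIV. pi_var i ^ (c $ i))"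
  by (subst pi_star_superset[of "{c}"]) auto

lemma poly_mapping_single_sum_induct [case_names single sum]:
  fixes Q :: "'a \<Rightarrow>\<^sub>0 'k::comm_monoid_add"
  assumes single: "\<And>c k. P (Poly_Mapping.single c k)"
    and sum: "\<And>f g. P f \<Longrightarrow> P g \<Longrightarrow> P (f + g)"
  shows "P Q"
proof (induction Q rule: Poly_Mapping.update_induct)
  case const
  show ?case using single[of undefined 0] by simp
next
  case (update f a b)
  have "Poly_Mapping.update a b f = Poly_Mapping.single a b + f"
    using update by (intro poly_mapping_eqI)
      (auto simp: lookup_add lookup_single lookup_update when_def in_keys_iff)
  then show ?case using update single sum by simp
qed

lemma pi_star_mult: "pi_star (P * Q) = pi_star P * pi_star Q"
proof -
  have mono: "pi_star (Poly_Mapping.single c k * Poly_Mapping.single c' k') =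
      pi_star (Poly_Mapping.single c k) * pi_star (Poly_Mapping.single c' k')"
    for c c' :: "'a nvec" and k k'
  proof -
    have *: "Poly_Mapping.single (0 :: 'a zvec) (k * k') =
             Poly_Mapping.single 0 k * Poly_Mapping.single 0 k'"
      by (simp add: mult_single)
    have "pi_star (Poly_Mapping.single c k * Poly_Mapping.single c' k') =
        Poly_Mapping.single 0 (k * k') *
        ((\<Prod>i\<in>UNIV. pi_var i ^ (c $ i)) * (\<Prod>i\<in>UNIV. pi_var i ^ (c' $ i)))"
      by (simp add: mult_single pi_star_single power_add prod.distrib)
    then show ?thesis
      unfolding * pi_star_single by (simp only: mult_ac)
  qed
  have 1: "pi_star (Poly_Mapping.single c k * Q) = pi_star (Poly_Mapping.single c k) * pi_star Q"
    for c :: "'a nvec" and k Q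
  proof (induction Q rule: poly_mapping_single_sum_induct)
    case (single c' k')
    show ?case by (rule mono)
  next
    case (sum f g)
    then show ?case by (simp add: distrib_left pi_star_add)
  qed
  show ?thesis
  proof (induction P rule: poly_mapping_single_sum_induct)
    case (single c k)
    show ?case by (rule 1)
  next
    case (sum f g)
    then show ?case by (simp add: distrib_right pi_star_add)
  qed
qed

lemma pi_star_const: "pi_star (Poly_Mapping.single 0 k) = Poly_Mapping.single 0 k"
  by (simp add: pi_star_single)

lemma pi_star_variable: "pi_star (Poly_Mapping.single (axis i 1) 1) = pi_var i"
proof -
  have "(\<Prod>j\<in>UNIV. pi_var j ^ (axis i 1 $ j)) = (\<Prod>j\<in>UNIV. if j = i then pi_var j else 1)"
    by (intro prod.cong) (auto simp: axis_def)
  then show ?thesis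
    by (simp add: pi_star_single)
qed

end

theory Submission
  imports Defs
begin

text \<open>Write a point \<open>x\<close> of the simplex \<open>\<Delta>\<^sub>k\<close> in homogeneous coordinates, that is, complete
  \<open>x\<^sub>1, ..., x\<^sub>n\<close> by \<open>x\<^sub>0 = d\<^sub>k - |x|\<close>. Then \<open>\<phi>\<^sub>k(x) = d\<^sub>k - x\<^sub>k\<close> for every \<open>k\<close>, including
  \<open>k = 0\<close>, and all indices play the same role. An exponent \<open>c\<close> with \<open>|c| = m\<close> corresponds to
  the lattice point \<open>b = (c\<^sub>1, ..., c\<^sub>n)\<close>, and the point \<open>p = b - \<delta>\<close> has homogeneous
  coordinates \<open>p\<^sub>j = c\<^sub>j + \<epsilon>\<^sub>j\<close> in \<open>\<Delta>\<close>, where \<open>\<epsilon>\<^sub>j = -\<delta>\<^sub>j\<close> for \<open>j > 0\<close> and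
  \<open>\<epsilon>\<^sub>0 = \<Sum>\<^sub>j (\<delta>\<^sub>j + 1)\<close>; the hypotheses on \<open>\<delta>\<close> say that these
  excesses lie strictly between \<open>0\<close> and \<open>1\<close> when \<open>n > 0\<close>. So \<open>p\<close> lies in \<open>\<Delta>\<close> exactly when all the
  \<open>c\<^sub>j\<close> are nonnegative, and dehomogenization of exponents is a bijection of the index sets
  of the two matrices (\<open>bij_betw_mac_I_ce_B\<close>).

  The heart of the matter is \<open>component_at_unshifted\<close>: if \<open>C\<close> is an \<open>n\<close>-cell of \<open>S(\<rho>)\<close>
  containing \<open>p\<close>, then \<open>C\<^sub>i\<close> is the single point \<open>d\<^sub>i e\<^sub>i\<close> if \<open>c\<^sub>i \<ge> d\<^sub>i\<close>, and has positive dimension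
  otherwise. By the refinement hypothesis \<open>C\<^sub>k\<close> is contained in the face of \<open>\<Delta>\<^sub>k\<close> minimizing
  \<open>\<phi>\<^sub>k + w\<close> for one and the same linear form \<open>w\<close>, whose coefficient at the index \<open>0\<close> is \<open>0\<close>. On
  \<open>\<Delta>\<^sub>k\<close> this function has the coefficients \<open>w\<^sub>j\<close>, diminished by \<open>1\<close> at \<open>j = k\<close>. If
  \<open>w\<^sub>i < min w + 1\<close>, then the smallest coefficient on \<open>\<Delta>\<^sub>i\<close> is the one at \<open>i\<close> alone, so
  \<open>C\<^sub>i = {d\<^sub>i e\<^sub>i}\<close> and hence \<open>p\<^sub>i \<ge> d\<^sub>i\<close>. If \<open>w\<^sub>i \<ge> min w + 1\<close>, then no minimizer on \<open>\<Delta>\<^sub>k\<close> with \<open>k \<noteq> i\<close>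
  involves the index \<open>i\<close>, so \<open>p\<^sub>i\<close> is the \<open>i\<close>-th coordinate of a point of \<open>C\<^sub>i\<close>; in particular
  \<open>p\<^sub>i \<le> d\<^sub>i\<close>. As \<open>p\<^sub>i\<close> is not an integer whereas \<open>C\<^sub>i\<close>, a face of a lattice simplex, contains a
  lattice point, \<open>C\<^sub>i\<close> is not a single point. These two cases form \<open>phi_component_dichotomy\<close>.

  It follows that the index \<open>i(b)\<close> is the largest \<open>i\<close> with \<open>c\<^sub>i \<ge> d\<^sub>i\<close>, that is, the \<open>i\<close> with
  \<open>c \<in> \<I>\<^sub>i\<close>, and that \<open>a(b) = d\<^sub>i e\<^sub>i\<close>; and, counting dimensions by tightness, that the cell of
  \<open>b\<close> is mixed exactly when \<open>c\<^sub>i \<ge> d\<^sub>i\<close> for a unique \<open>i\<close> (\<open>mixed_cell_iff\<close>). Hence \<open>\<pi>\<^sub>*\<close> maps the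
  monomial bases to one another. As it is multiplicative and maps \<open>P\<^sub>i\<close> to \<open>F\<^sub>i\<close>
  (\<open>pi_star_mac_P\<close>), the diagram commutes, and the matrices agree because a homogeneous polynomial
  and its dehomogenization have the same coefficients.

  Two general facts about inf-convolutions are used: the components of the cell in direction \<open>v\<close>
  are the cells of the summands in direction \<open>v\<close> (\<open>component_cell\<close>), and for a generic shift there
  is exactly one \<open>n\<close>-cell through a shifted lattice point in the relative interior
  (\<open>generic_unique_ncell\<close>).\<close>

section \<open>Cells of an inf-convolution and their components\<close>

lemma compact_vec_components:
  fixes D :: "'i::finite \<Rightarrow> ('a::euclidean_space) set"
  assumes "\<And>i. compact (D i)"
  shows "compact {Y :: 'a ^ 'i. \<forall>i. Y $ i \<in> D i}"
proof -
  have "{Y :: 'a ^ 'i. \<forall>i. Y $ i \<in> D i} = (\<Inter>i. (\<lambda>Y. Y $ i) -` D i)"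
    by auto
  moreover have "closed (\<Inter>i. (\<lambda>Y :: 'a ^ 'i. Y $ i) -` D i)"
    using assms by (intro closed_INT ballI closed_vimage) (auto intro!: continuous_intros compact_imp_closed)
  moreover obtain M where M: "\<And>i x. x \<in> D i \<Longrightarrow> norm x \<le> M i"
    using assms[THEN compact_imp_bounded] unfolding bounded_iff by metis
  have "bounded {Y :: 'a ^ 'i. \<forall>i. Y $ i \<in> D i}"
  proof (rule boundedI)
    fix Y :: "'a ^ 'i" assume Y: "Y \<in> {Y. \<forall>i. Y $ i \<in> D i}"
    have "norm Y \<le> (\<Sum>i\<in>UNIV. norm (Y $ i))"
      unfolding norm_vec_def by (rule L2_set_le_sum) simp
    also have "\<dots> \<le> (\<Sum>i\<in>UNIV. M i)"
      using Y M by (intro sum_mono) auto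
    finally show "norm Y \<le> (\<Sum>i\<in>UNIV. M i)" .
  qed
  ultimately show ?thesis
    by (simp add: compact_eq_bounded_closed)
qed

text \<open>Decompositions of \<open>x\<close> into points of the \<open>D i\<close> form a compact set, so the infimum
  is a minimum. Minimality is also stated directly, without \<open>Inf\<close>, for use with other
  decompositions.\<close>

lemma inf_conv_attained:
  fixes D :: "'i::finite \<Rightarrow> 'i rvec set"
  assumes D: "\<And>i. compact (D i)" and r: "\<And>i. continuous_on (D i) (r i)"
    and x: "x \<in> mink_sum D"
  obtains y where "\<And>i. y i \<in> D i" "sum y UNIV = x"
    "inf_conv D r x = (\<Sum>i\<in>UNIV. r i (y i))"
    "\<And>z. (\<And>i. z i \<in> D i) \<Longrightarrow> sum z UNIV = x \<Longrightarrow>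
       (\<Sum>i\<in>UNIV. r i (y i)) \<le> (\<Sum>i\<in>UNIV. r i (z i))"
proof -
  define S where "S = {Y :: 'i rvec ^ 'i. \<forall>i. Y $ i \<in> D i} \<inter> {Y. (\<Sum>i\<in>UNIV. Y $ i) = x}"
  have "closed {Y :: 'i rvec ^ 'i. (\<Sum>i\<in>UNIV. Y $ i) = x}"
    by (intro closed_Collect_eq continuous_intros)
  then have "compact S"
    unfolding S_def by (intro compact_Int_closed compact_vec_components D)
  moreover have "S \<noteq> {}"
  proof -
    obtain z where "\<forall>i. z i \<in> D i" "(\<Sum>i\<in>UNIV. z i) = x"
      using x by (auto simp: mink_sum_def)
    then have "(\<chi> i. z i) \<in> S" by (simp add: S_def)
    then show ?thesis by auto
  qed
  moreover have "continuous_on S (\<lambda>Y. \<Sum>i\<in>UNIV. r i (Y $ i))"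
    by (intro continuous_on_sum continuous_on_compose2[OF r] continuous_intros) (auto simp: S_def)
  ultimately obtain Y where Y: "Y \<in> S"
    "\<And>Z. Z \<in> S \<Longrightarrow> (\<Sum>i\<in>UNIV. r i (Y $ i)) \<le> (\<Sum>i\<in>UNIV. r i (Z $ i))"
    using continuous_attains_inf[of S] by blast
  have min: "(\<Sum>i\<in>UNIV. r i (Y $ i)) \<le> (\<Sum>i\<in>UNIV. r i (z i))"
    if "\<And>i. z i \<in> D i" "sum z UNIV = x" for z
    using Y(2)[of "\<chi> i. z i"] that by (simp add: S_def)
  have "inf_conv D r x = (\<Sum>i\<in>UNIV. r i (Y $ i))"
    unfolding inf_conv_def
  proof (rule cInf_eq_minimum)
    show "(\<Sum>i\<in>UNIV. r i (Y $ i)) \<in>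
        {\<Sum>i\<in>UNIV. r i (y i) |y. (\<forall>i. y i \<in> D i) \<and> sum y UNIV = x}"
      using Y(1) by (auto simp: S_def intro!: exI[of _ "\<lambda>i. Y $ i"])
  qed (use min in auto)
  then show ?thesis
    using Y(1) min by (intro that[of "\<lambda>i. Y $ i"]) (auto simp: S_def)
qed

lemma inf_conv_le:
  fixes D :: "'i::finite \<Rightarrow> 'i rvec set"
  assumes "\<And>i. compact (D i)" "\<And>i. continuous_on (D i) (r i)" "\<And>i. y i \<in> D i"
  shows "inf_conv D r (sum y UNIV) \<le> (\<Sum>i\<in>UNIV. r i (y i))"
proof -
  have "sum y UNIV \<in> mink_sum D"
    using assms(3) by (auto simp: mink_sum_def)
  then show ?thesis
    by (rule inf_conv_attained[OF assms(1,2)]) (use assms(3) in auto)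
qed

lemma cell_nonempty:
  assumes "compact D" "D \<noteq> {}" "continuous_on D r"
  shows "cell D r v \<noteq> {}"
proof -
  have "continuous_on D (\<lambda>x. r x + v \<bullet> x)"
    by (intro continuous_intros assms)
  from continuous_attains_inf[OF assms(1,2) this] show ?thesis
    unfolding cell_def by blast
qed

text \<open>Adding the linear form to each summand turns minimization over the Minkowski sum into
  independent minimizations over the \<open>D i\<close>: a sum is minimal if and only if every term is. For
  the inclusion from left to right, one term of an optimal decomposition is exchanged.\<close>

lemma component_cell:
  fixes D :: "'i::finite \<Rightarrow> 'i rvec set"
  assumes D: "\<And>i. compact (D i)" "\<And>i. D i \<noteq> {}" and r: "\<And>i. continuous_on (D i) (r i)"
  shows "component D r (cell (mink_sum D) (inf_conv D r) v) i = cell (D i) (r i) v"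
proof (intro equalityI subsetI)
  fix y assume "y \<in> component D r (cell (mink_sum D) (inf_conv D r) v) i"
  then obtain x where y: "y = x i" and x: "\<And>j. x j \<in> D j"
    and min: "\<And>z. z \<in> mink_sum D \<Longrightarrow>
      inf_conv D r (sum x UNIV) + v \<bullet> sum x UNIV \<le> inf_conv D r z + v \<bullet> z"
    and eq: "inf_conv D r (sum x UNIV) = (\<Sum>j\<in>UNIV. r j (x j))"
    by (auto simp: component_def cell_def)
  have "r i y + v \<bullet> y \<le> r i z + v \<bullet> z" if "z \<in> D i" for z
  proof -
    define x' where "x' = x(i := z)"
    have x': "x' j \<in> D j" for j using x that by (simp add: x'_def)
    then have "sum x' UNIV \<in> mink_sum D" by (auto simp: mink_sum_def)
    from min[OF this] inf_conv_le[of D r x', OF D(1) r x']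
    have "(\<Sum>j\<in>UNIV. r j (x j)) + v \<bullet> sum x UNIV \<le> (\<Sum>j\<in>UNIV. r j (x' j)) + v \<bullet> sum x' UNIV"
      by (simp add: eq)
    then have "(\<Sum>j\<in>UNIV. r j (x j) + v \<bullet> x j) \<le> (\<Sum>j\<in>UNIV. r j (x' j) + v \<bullet> x' j)"
      by (simp add: sum.distrib inner_sum_right)
    moreover have "(\<Sum>j\<in>UNIV-{i}. r j (x' j) + v \<bullet> x' j) = (\<Sum>j\<in>UNIV-{i}. r j (x j) + v \<bullet> x j)"
      by (intro sum.cong) (auto simp: x'_def)
    ultimately show ?thesis
      by (simp add: sum.remove[of UNIV i] x'_def y)
  qed
  then show "y \<in> cell (D i) (r i) v"
    using x by (auto simp: cell_def y)
next
  fix y assume y: "y \<in> cell (D i) (r i) v"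
  obtain x0 where x0: "\<And>j. x0 j \<in> cell (D j) (r j) v"
  proof -
    have "\<forall>j. \<exists>z. z \<in> cell (D j) (r j) v"
      using cell_nonempty[OF D r] by (meson ex_in_conv)
    then show ?thesis using that by metis
  qed
  define x where "x = x0(i := y)"
  have x: "x j \<in> cell (D j) (r j) v" for j using x0 y by (simp add: x_def)
  then have xD: "x j \<in> D j" for j by (auto simp: cell_def)
  have sum_le: "(\<Sum>j\<in>UNIV. r j (x j)) + v \<bullet> sum x UNIV \<le> (\<Sum>j\<in>UNIV. r j (z j)) + v \<bullet> sum z UNIV"
    if "\<And>j. z j \<in> D j" for z
  proof -
    have "(\<Sum>j\<in>UNIV. r j (x j) + v \<bullet> x j) \<le> (\<Sum>j\<in>UNIV. r j (z j) + v \<bullet> z j)"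
      using x that by (intro sum_mono) (auto simp: cell_def)
    then show ?thesis by (simp add: sum.distrib inner_sum_right)
  qed
  have xm: "sum x UNIV \<in> mink_sum D" using xD by (auto simp: mink_sum_def)
  have eq: "inf_conv D r (sum x UNIV) = (\<Sum>j\<in>UNIV. r j (x j))"
  proof (rule antisym[OF inf_conv_le[OF D(1) r xD]])
    show "(\<Sum>j\<in>UNIV. r j (x j)) \<le> inf_conv D r (sum x UNIV)"
    proof (rule inf_conv_attained[OF D(1) r xm])
      fix z assume "\<And>j. z j \<in> D j" "sum z UNIV = sum x UNIV"
        "inf_conv D r (sum x UNIV) = (\<Sum>j\<in>UNIV. r j (z j))"
      then show ?thesis using sum_le[of z] by simp
    qed
  qed
  have "inf_conv D r (sum x UNIV) + v \<bullet> sum x UNIV \<le> inf_conv D r z + v \<bullet> z"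
    if "z \<in> mink_sum D" for z
    by (rule inf_conv_attained[OF D(1) r that]) (use sum_le eq in force)
  then have "sum x UNIV \<in> cell (mink_sum D) (inf_conv D r) v"
    using xm by (simp add: cell_def)
  then show "y \<in> component D r (cell (mink_sum D) (inf_conv D r) v) i"
    using xD eq unfolding component_def by (auto intro!: exI[of _ x] simp: x_def)
qed

text \<open>An optimal decomposition of a point of a cell has its terms in the components. This is how
  information on the components is turned into information on the coordinates of the point.\<close>

lemma component_sum:
  fixes D :: "'i::finite \<Rightarrow> 'i rvec set"
  assumes D: "\<And>i. compact (D i)" and r: "\<And>i. continuous_on (D i) (r i)"
    and p: "p \<in> cell (mink_sum D) (inf_conv D r) v"
  obtains x where "\<And>i. x i \<in> component D r (cell (mink_sum D) (inf_conv D r) v) i"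
    "sum x UNIV = p"
proof -
  have "p \<in> mink_sum D" using p by (simp add: cell_def)
  then show ?thesis
  proof (rule inf_conv_attained[OF D r])
    fix x assume "\<And>i. x i \<in> D i" "sum x UNIV = p"
      "inf_conv D r p = (\<Sum>i\<in>UNIV. r i (x i))"
    then show ?thesis
      using p by (intro that[of x]) (auto simp: component_def)
  qed
qed

lemma mink_sum_convex_comb:
  assumes "\<And>i. convex (D i)" "x \<in> mink_sum D" "y \<in> mink_sum D" "0 \<le> u" "0 \<le> w" "u + w = 1"
  shows "u *\<^sub>R x + w *\<^sub>R y \<in> mink_sum D"
proof -
  obtain f g where "\<forall>i. f i \<in> D i" "x = sum f UNIV" "\<forall>i. g i \<in> D i" "y = sum g UNIV"
    using assms(2,3) by (auto simp: mink_sum_def)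
  then show ?thesis
    using assms unfolding mink_sum_def
    by (auto intro!: exI[of _ "\<lambda>i. u *\<^sub>R f i + w *\<^sub>R g i"] simp: sum.distrib scaleR_sum_right convexD)
qed

lemma inf_conv_convex:
  fixes D :: "'i::finite \<Rightarrow> 'i rvec set"
  assumes D: "\<And>i. compact (D i)" and r: "\<And>i. continuous_on (D i) (r i)"
    and rc: "\<And>i. convex_on (D i) (r i)"
  shows "convex_on (mink_sum D) (inf_conv D r)"
proof -
  have Dc: "convex (D i)" for i using rc convex_on_imp_convex by blast
  show ?thesis unfolding convex_on_def
  proof (intro conjI ballI allI impI)
    show "convex (mink_sum D)"
      unfolding convex_def using mink_sum_convex_comb[of D, OF Dc] by blast
    fix x y and u w :: real
    assume x: "x \<in> mink_sum D" and y: "y \<in> mink_sum D" and u: "0 \<le> u" "0 \<le> w" "u + w = 1"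
    obtain f where f: "\<And>i. f i \<in> D i" "sum f UNIV = x" "inf_conv D r x = (\<Sum>i\<in>UNIV. r i (f i))"
      using inf_conv_attained[OF D r x] by blast
    obtain g where g: "\<And>i. g i \<in> D i" "sum g UNIV = y" "inf_conv D r y = (\<Sum>i\<in>UNIV. r i (g i))"
      using inf_conv_attained[OF D r y] by blast
    define h where "h = (\<lambda>i. u *\<^sub>R f i + w *\<^sub>R g i)"
    have h: "h i \<in> D i" for i using f g u Dc by (auto simp: h_def convexD)
    have "u *\<^sub>R x + w *\<^sub>R y = sum h UNIV"
      by (simp add: h_def sum.distrib f(2)[symmetric] g(2)[symmetric] scaleR_sum_right)
    then have "inf_conv D r (u *\<^sub>R x + w *\<^sub>R y) \<le> (\<Sum>i\<in>UNIV. r i (h i))"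
      using inf_conv_le[OF D r h] by simp
    also have "\<dots> \<le> (\<Sum>i\<in>UNIV. u * r i (f i) + w * r i (g i))"
      using f g u rc by (intro sum_mono) (auto simp: h_def convex_on_def)
    finally show "inf_conv D r (u *\<^sub>R x + w *\<^sub>R y) \<le> u * inf_conv D r x + w * inf_conv D r y"
      by (simp add: f(3) g(3) sum.distrib sum_distrib_left)
  qed
qed

section \<open>Existence and uniqueness of the n-cell through a point\<close>

text \<open>The point \<open>(p, f p)\<close> is on the relative boundary of the epigraph, which therefore has a
  supporting hyperplane there. The hypothesis \<open>int\<close> puts \<open>p\<close> in the relative interior of \<open>S\<close>,
  in the form of prolongation of segments beyond \<open>p\<close>; it excludes vertical hyperplanes.\<close>

lemma convex_on_subgradient:
  fixes f :: "'a::euclidean_space \<Rightarrow> real"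
  assumes f: "convex_on S f" and p: "p \<in> S"
    and int: "\<And>y. y \<in> S \<Longrightarrow> \<exists>e>0. p + e *\<^sub>R (p - y) \<in> S"
  obtains v where "\<And>y. y \<in> S \<Longrightarrow> f p + v \<bullet> p \<le> f y + v \<bullet> y"
proof -
  define E where "E = epigraph S f"
  have E: "convex E" using f by (simp add: E_def convex_epigraph)
  have pE: "(p, f p + t) \<in> E" if "t \<ge> 0" for t using p that by (simp add: E_def mem_epigraph)
  have "(p, f p) \<notin> rel_interior E"
  proof
    assume "(p, f p) \<in> rel_interior E"
    then obtain e where e: "e > 0" "cball (p, f p) e \<inter> affine hull E \<subseteq> E"
      by (auto simp: mem_rel_interior_cball)
    \<comment> \<open>Prolonging the vertical segment from \<open>(p, f p + 1)\<close> leads below the graph.\<close>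
    have "(1 + e) *\<^sub>R (p, f p) + (- e) *\<^sub>R (p, f p + 1) \<in> affine hull E"
      using pE[of 0] pE[of 1] by (intro mem_affine affine_affine_hull hull_inc) auto
    also have "(1 + e) *\<^sub>R (p, f p) + (- e) *\<^sub>R (p, f p + 1) = (p, f p - e)"
      by (simp add: scaleR_left_distrib algebra_simps)
    finally have "(p, f p - e) \<in> E"
      using e by (auto simp: dist_prod_def dist_real_def)
    then show False using e by (simp add: E_def mem_epigraph)
  qed
  moreover have "(p, f p) \<in> closure E"
    using pE[of 0] closure_subset by auto
  ultimately obtain a where a: "a \<noteq> 0" "\<And>y. y \<in> closure E \<Longrightarrow> a \<bullet> (p, f p) \<le> a \<bullet> y"
    "\<And>y. y \<in> rel_interior E \<Longrightarrow> a \<bullet> (p, f p) < a \<bullet> y"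
    using supporting_hyperplane_relative_frontier[OF E, of "(p, f p)"] by metis
  obtain v s where as: "a = (v, s)" by (cases a)
  have le: "v \<bullet> p + s * f p \<le> v \<bullet> y + s * t" if "y \<in> S" "f y \<le> t" for y t
    using a(2)[of "(y, t)"] that subsetD[OF closure_subset, of "(y, t)" E]
    by (simp add: as E_def mem_epigraph)
  have "s \<ge> 0" using le[of p "f p + 1"] p by (simp add: algebra_simps)
  moreover have "s \<noteq> 0"
  proof
    assume s: "s = 0"
    have "v \<bullet> y = v \<bullet> p" if y: "y \<in> S" for y
    proof -
      obtain e where e: "e > 0" "p + e *\<^sub>R (p - y) \<in> S" using int[OF y] by blast
      have "v \<bullet> p \<le> v \<bullet> (p + e *\<^sub>R (p - y))" using le[OF e(2) order_refl] s by simp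
      then have "0 \<le> e * (v \<bullet> p - v \<bullet> y)" by (simp add: inner_add_right inner_diff_right)
      then have "v \<bullet> y \<le> v \<bullet> p" using e(1) by (simp add: zero_le_mult_iff)
      then show ?thesis using le[OF y order_refl] s by simp
    qed
    then have "a \<bullet> (p, f p) = a \<bullet> z" if "z \<in> E" for z
      using that by (cases z) (auto simp: as s E_def mem_epigraph)
    moreover have "rel_interior E \<noteq> {}"
      using E pE[of 0] rel_interior_eq_empty by auto
    ultimately show False
      using a(3) rel_interior_subset[of E] by fastforce
  qed
  ultimately have s: "s > 0" by simp
  have "f p + (inverse s *\<^sub>R v) \<bullet> p \<le> f y + (inverse s *\<^sub>R v) \<bullet> y" if "y \<in> S" for y
    proof -
    have "inverse s * (v \<bullet> p + s * f p) \<le> inverse s * (v \<bullet> y + s * f y)"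
      using le[OF that order_refl] s by (intro mult_left_mono) auto
    moreover have "inverse s * (c + s * t) = t + inverse s * c" for c t
      using s by (simp add: distrib_left flip: mult.assoc)
    ultimately show ?thesis by simp
  qed
  then show ?thesis by (rule that)
qed

lemma subspace_coords1n: "subspace (coords1n :: 'i::{finite,linorder} rvec set)"
  by (auto simp: subspace_def coords1n_def)

lemma aff_dim_coords1n:
  "aff_dim (coords1n :: 'i::{finite,linorder} rvec set) = int (ndim TYPE('i))"
proof -
  have eq: "coords1n = {x :: 'i rvec. axis ix0 1 \<bullet> x = 0}"
    by (simp add: coords1n_def inner_axis')
  have "axis ix0 1 \<noteq> (0 :: 'i rvec)"
    by simp
  then have "aff_dim (coords1n :: 'i rvec set) = int (DIM('i rvec)) - 1"
    unfolding eq using aff_dim_hyperplane[of "axis ix0 1 :: 'i rvec" 0] by fastforce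
  then show ?thesis
    by (simp add: ndim_def of_nat_diff Suc_leI)
qed

text \<open>Existence: a subgradient at \<open>p\<close> gives a cell through \<open>p\<close>, and by genericity every cell
  through \<open>p\<close> has full dimension. Uniqueness: if \<open>p\<close> lies in the cells of \<open>v\<close> and \<open>w\<close>, then the
  cell of the midpoint of \<open>v\<close> and \<open>w\<close> also contains \<open>p\<close>, hence is full-dimensional; but
  \<open>v - w\<close> is constant on it, so \<open>v = w\<close>.\<close>

lemma generic_unique_ncell:
  fixes D :: "'i::{finite,linorder} \<Rightarrow> 'i rvec set"
  assumes D: "\<And>i. compact (D i)" "\<And>i. D i \<subseteq> coords1n"
    and r: "\<And>i. continuous_on (D i) (r i)" "\<And>i. convex_on (D i) (r i)"
    and gen: "generic_shift D r \<delta>"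
    and b: "b \<in> coords1n" "rvec_of b = \<delta> + p" "p \<in> mink_sum D"
    and int: "\<And>y. y \<in> mink_sum D \<Longrightarrow> \<exists>e>0. p + e *\<^sub>R (p - y) \<in> mink_sum D"
  shows "\<exists>!C. C \<in> ncells D r \<and> rvec_of b \<in> (+) \<delta> ` C"
proof -
  let ?cell = "cell (mink_sum D) (inf_conv D r)"
  have sub: "mink_sum D \<subseteq> coords1n"
    using D(2) by (auto simp: mink_sum_def intro!: subspace_sum[OF subspace_coords1n])
  have dim_le: "aff_dim (?cell v) \<le> int (ndim TYPE('i))" for v
    unfolding aff_dim_coords1n[symmetric] using sub by (intro aff_dim_subset) (auto simp: cell_def)
  have mem: "rvec_of b \<in> (+) \<delta> ` C \<longleftrightarrow> p \<in> C" for C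
    by (auto simp: b(2))
  have ncell: "aff_dim (?cell v) = int (ndim TYPE('i))" if "v \<in> coords1n" "p \<in> ?cell v" for v
  proof (rule ccontr)
    assume "aff_dim (?cell v) \<noteq> int (ndim TYPE('i))"
    then have "aff_dim (?cell v) \<le> int (ndim TYPE('i)) - 1" using dim_le[of v] by simp
    then show False
      using gen that b(1) mem[of "?cell v"]
      unfolding generic_shift_def mixed_subdiv_def cells_def by blast
  qed
  obtain v0 where v0: "\<And>y. y \<in> mink_sum D \<Longrightarrow> inf_conv D r p + v0 \<bullet> p \<le> inf_conv D r y + v0 \<bullet> y"
    using convex_on_subgradient[OF inf_conv_convex[OF D(1) r] b(3) int] by blast
  \<comment> \<open>Directions of cells have vanishing coordinate \<open>ix0\<close>; on \<open>coords1n\<close> that coordinate has no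
    effect on the linear form.\<close>
  define v where "v = v0 - axis ix0 (v0 $ ix0)"
  have v: "v \<in> coords1n" by (simp add: v_def coords1n_def)
  have "v \<bullet> y = v0 \<bullet> y" if "y \<in> mink_sum D" for y
    using that sub by (auto simp: v_def inner_diff_left inner_axis' coords1n_def)
  then have pv: "p \<in> ?cell v"
    using v0 b(3) by (simp add: cell_def)
  show ?thesis
  proof (rule ex1I[of _ "?cell v"])
    show "?cell v \<in> ncells D r \<and> rvec_of b \<in> (+) \<delta> ` ?cell v"
      using v pv ncell[OF v pv] mem by (auto simp: ncells_def mixed_subdiv_def cells_def)
    fix C assume C: "C \<in> ncells D r \<and> rvec_of b \<in> (+) \<delta> ` C"
    then obtain w where w: "w \<in> coords1n" "C = ?cell w" and pw: "p \<in> ?cell w"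
      using mem by (auto simp: ncells_def mixed_subdiv_def cells_def)
    \<comment> \<open>The cell of the midpoint is the intersection of the two cells.\<close>
    define u where "u = (1/2) *\<^sub>R v + (1/2) *\<^sub>R w"
    have u: "u \<in> coords1n" using v w(1) by (simp add: u_def coords1n_def)
    have in_u: "2 * (u \<bullet> y) = v \<bullet> y + w \<bullet> y" for y by (simp add: u_def inner_add_left)
    have pvw: "inf_conv D r p + v \<bullet> p \<le> inf_conv D r y + v \<bullet> y"
      "inf_conv D r p + w \<bullet> p \<le> inf_conv D r y + w \<bullet> y" if "y \<in> mink_sum D" for y
      using pv pw that by (auto simp: cell_def)
    have pu: "p \<in> ?cell u"
      unfolding cell_def
    proof (intro CollectI conjI ballI b(3))
      fix y assume "y \<in> mink_sum D"
      from pvw[OF this] in_u[of y] in_u[of p]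
      show "inf_conv D r p + u \<bullet> p \<le> inf_conv D r y + u \<bullet> y" by linarith
    qed
    have "?cell u \<subseteq> {x. (v - w) \<bullet> x = (v - w) \<bullet> p}"
    proof
      fix x assume x: "x \<in> ?cell u"
      then have "x \<in> mink_sum D" "inf_conv D r x + u \<bullet> x \<le> inf_conv D r p + u \<bullet> p"
        using b(3) by (auto simp: cell_def)
      with pvw[of x] in_u[of x] in_u[of p] show "x \<in> {x. (v - w) \<bullet> x = (v - w) \<bullet> p}"
        by (simp add: inner_diff_left)
    qed
    moreover have "affine {x. (v - w) \<bullet> x = (v - w) \<bullet> p}"
      by (rule affine_hyperplane)
    ultimately have hull: "affine hull ?cell u \<subseteq> {x. (v - w) \<bullet> x = (v - w) \<bullet> p}"
      by (rule hull_minimal)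
    have "affine hull ?cell u = coords1n"
    proof (rule affine_dim_equal)
      show "affine hull ?cell u \<subseteq> coords1n"
        using sub by (intro hull_minimal subspace_imp_affine subspace_coords1n) (auto simp: cell_def)
    qed (use ncell[OF u pu] pu in \<open>auto simp: aff_dim_coords1n subspace_imp_affine subspace_coords1n\<close>)
    moreover have "p + (v - w) \<in> coords1n"
      using v w(1) b(3) sub by (auto simp: coords1n_def)
    ultimately have "(v - w) \<bullet> (p + (v - w)) = (v - w) \<bullet> p" using hull by auto
    then have "v = w" by (simp add: inner_add_right)
    then show "C = ?cell v" using w by simp
  qed
qed


section \<open>Coordinate sums\<close>

lemma vsum_split:
  fixes x :: "'a::comm_monoid_add ^ 'i::{finite,linorder}"
  shows "vsum x = x $ ix0 + (\<Sum>j\<in>UNIV - {ix0}. x $ j)"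
  unfolding vsum_def by (rule sum.remove) auto

lemma vsum_axis [simp]: "vsum (axis i a) = a"
  by (simp add: vsum_def axis_def)

lemma vsum_add: "vsum (x + y) = vsum x + vsum y"
  by (simp add: vsum_def sum.distrib)

lemma nth_le_vsum: "c $ i \<le> vsum c" for c :: "'i::finite nvec"
  unfolding vsum_def by (rule member_le_sum) auto

lemma finite_vsum_eq: "finite {c :: 'i::finite nvec. vsum c = e}"
proof (rule finite_subset)
  show "{c :: 'i nvec. vsum c = e} \<subseteq> vec_lambda ` (UNIV \<rightarrow>\<^sub>E {..e})"
  proof
    fix c :: "'i nvec" assume "c \<in> {c. vsum c = e}"
    then have "($) c \<in> UNIV \<rightarrow>\<^sub>E {..e}" using nth_le_vsum[of c] by auto
    moreover have "c = vec_lambda (($) c)" by simp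
    ultimately show "c \<in> vec_lambda ` (UNIV \<rightarrow>\<^sub>E {..e})" by blast
  qed
qed (intro finite_imageI finite_PiE, auto)

section \<open>Dehomogenization of exponents and polynomials\<close>

lemma prod_single_one:
  "(\<Prod>i\<in>A. Poly_Mapping.single (f i) 1) = Poly_Mapping.single (\<Sum>i\<in>A. f i) (1 :: ufrac)"
proof (cases "finite A")
  case True
  then show ?thesis by (induction A) (auto simp: mult_single)
qed simp

lemma sum_single_keys:
  "(\<Sum>c\<in>Poly_Mapping.keys Q. Poly_Mapping.single c (Poly_Mapping.lookup Q c)) = Q"
  by (intro poly_mapping_eqI) (auto simp: lookup_sum lookup_single when_def in_keys_iff)

definition dehomogenize :: "'i nvec \<Rightarrow> 'i::{finite,linorder} zvec" where
  "dehomogenize c = (\<chi> j. if j = ix0 then 0 else int (c $ j))"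

lemma dehomogenize_in_coords1n: "dehomogenize c \<in> coords1n"
  by (simp add: dehomogenize_def coords1n_def)

lemma vsum_dehomogenize: "vsum (dehomogenize c) = int (vsum c) - int (c $ ix0)"
proof -
  have "(\<Sum>j\<in>UNIV - {ix0}. dehomogenize c $ j) = int (\<Sum>j\<in>UNIV - {ix0}. c $ j)"
    by (simp add: dehomogenize_def)
  then show ?thesis
    unfolding vsum_split by (simp add: dehomogenize_def)
qed

lemma homogenize_dehomogenize:
  assumes "vsum c = e"
  shows "homogenize e (dehomogenize c) = c"
proof (rule vec_eq_iff[THEN iffD2], rule allI)
  fix j
  have "int (vsum c) - (int (vsum c) - int (c $ ix0)) = int (c $ ix0)" by simp
  then show "homogenize e (dehomogenize c) $ j = c $ j"
    using assms nth_le_vsum[of c ix0] unfolding homogenize_def vsum_dehomogenize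
    by (auto simp: dehomogenize_def nat_diff_distrib)
qed

lemma dehomogenize_homogenize:
  assumes "a \<in> coords1n" "\<And>j. 0 \<le> a $ j"
  shows "dehomogenize (homogenize e a) = a"
  using assms by (auto simp: vec_eq_iff homogenize_def dehomogenize_def coords1n_def)

lemma vsum_homogenize:
  assumes "a \<in> coords1n" "\<And>j. 0 \<le> a $ j" "vsum a \<le> int e"
  shows "vsum (homogenize e a) = e"
proof -
  have "vsum a = (\<Sum>j\<in>UNIV - {ix0}. a $ j)"
    using assms(1) by (simp add: vsum_split coords1n_def)
  also have "\<dots> = int (\<Sum>j\<in>UNIV - {ix0}. homogenize e a $ j)"
    using assms(2) by (simp add: homogenize_def)
  finally have "vsum a = int (\<Sum>j\<in>UNIV - {ix0}. homogenize e a $ j)" .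
  moreover have "homogenize e a $ ix0 = e - nat (vsum a)"
    by (simp add: homogenize_def)
  ultimately show ?thesis
    using assms(3) unfolding vsum_split[of "homogenize e a"] by linarith
qed

text \<open>The lost coordinate is determined by the degree.\<close>

lemma dehomogenize_inj:
  assumes "dehomogenize c = dehomogenize c'" "vsum c = vsum c'"
  shows "c = c'"
  using assms homogenize_dehomogenize by metis

lemma bij_betw_dehomogenize:
  "bij_betw dehomogenize {c. vsum c = e}
     {a \<in> coords1n. (\<forall>j. 0 \<le> a $ j) \<and> vsum a \<le> int e}"
  by (rule bij_betw_byWitness[of _ "homogenize e"])
    (auto simp: homogenize_dehomogenize dehomogenize_homogenize vsum_homogenize vsum_dehomogenize
      dehomogenize_in_coords1n, simp add: dehomogenize_def)

lemma dehomogenize_diff_axis: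
  assumes "e \<le> c $ i"
  shows "dehomogenize (c - axis i e) = dehomogenize c - dehomogenize (axis i e)"
  using assms by (auto simp: vec_eq_iff dehomogenize_def axis_def of_nat_diff)

lemma pi_star_monomial:
  "pi_star (Poly_Mapping.single c k) = Poly_Mapping.single (dehomogenize c) k"
proof -
  define g :: "'a \<Rightarrow> 'a zvec" where "g i = (if i = ix0 then 0 else axis i 1)" for i
  have "pi_var i ^ m = Poly_Mapping.single (\<chi> j. int m * g i $ j) (1 :: ufrac)" for i m
  proof (induction m)
    case 0
    show ?case by (simp flip: zero_vec_def)
  next
    case (Suc m)
    have "g i + (\<chi> j. int m * g i $ j) = (\<chi> j. int (Suc m) * g i $ j)"
      by (simp add: vec_eq_iff algebra_simps)
    moreover have "pi_var i = Poly_Mapping.single (g i) 1"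
      by (simp add: pi_var_def g_def)
    ultimately show ?case using Suc by (simp add: mult_single)
  qed
  moreover have "(\<Sum>i\<in>UNIV. \<chi> j. int (c $ i) * g i $ j) = dehomogenize c"
  proof (rule vec_eq_iff[THEN iffD2], rule allI)
    fix j
    have "(\<Sum>i\<in>UNIV. int (c $ i) * g i $ j) =
        (\<Sum>i\<in>UNIV. if i = j then (if j = ix0 then 0 else int (c $ j)) else 0)"
      by (intro sum.cong) (auto simp: g_def axis_def)
    then show "(\<Sum>i\<in>UNIV. \<chi> j. int (c $ i) * g i $ j) $ j = dehomogenize c $ j"
      by (simp add: dehomogenize_def)
  qed
  ultimately show ?thesis
    by (simp add: pi_star_single prod_single_one mult_single)
qed

lemma pi_star_0: "pi_star 0 = 0"
  by (simp add: pi_star_def)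

lemma pi_star_sum_of: "pi_star (\<Sum>x\<in>X. f x) = (\<Sum>x\<in>X. pi_star (f x))"
proof (cases "finite X")
  case True
  then show ?thesis by (induction X) (auto simp: pi_star_add pi_star_0)
qed (simp add: pi_star_0)

lemma pi_star_eq_sum:
  "pi_star Q = (\<Sum>c\<in>Poly_Mapping.keys Q. Poly_Mapping.single (dehomogenize c) (Poly_Mapping.lookup Q c))"
  by (subst (1) sum_single_keys[of Q, symmetric]) (simp only: pi_star_sum_of pi_star_monomial)

text \<open>On homogeneous polynomials dehomogenization merges no monomials. This is why the matrix
  entries are unchanged.\<close>

lemma lookup_pi_star:
  assumes "\<And>c. c \<in> Poly_Mapping.keys Q \<Longrightarrow> vsum c = vsum c'"
  shows "Poly_Mapping.lookup (pi_star Q) (dehomogenize c') = Poly_Mapping.lookup Q c'"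
proof -
  have "Poly_Mapping.lookup (pi_star Q) (dehomogenize c') =
      (\<Sum>c\<in>Poly_Mapping.keys Q. Poly_Mapping.lookup Q c when dehomogenize c = dehomogenize c')"
    by (simp add: pi_star_eq_sum lookup_sum lookup_single)
  also have "\<dots> = (\<Sum>c\<in>Poly_Mapping.keys Q. Poly_Mapping.lookup Q c when c = c')"
    using dehomogenize_inj assms by (intro sum.cong) (auto simp: when_def)
  also have "\<dots> = Poly_Mapping.lookup Q c'"
    by (simp add: when_def in_keys_iff)
  finally show ?thesis .
qed

lemma pi_star_mac_P: "pi_star (mac_P d i) = gen_F d i"
proof -
  have "gen_F d i = (\<Sum>c | vsum c = d $ i. Poly_Mapping.single (dehomogenize c)
      (uvar i (homogenize (d $ i) (dehomogenize c))))"
    unfolding gen_F_def supp_A_def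
    using sum.reindex_bij_betw[OF bij_betw_dehomogenize,
        where g = "\<lambda>a. Poly_Mapping.single a (uvar i (homogenize (d $ i) a))"]
    by simp
  then show ?thesis
    by (simp add: mac_P_def pi_star_sum_of pi_star_monomial homogenize_dehomogenize)
qed

lemma pi_star_mac_Psi: "pi_star (mac_Psi d Q) = ce_Phi (gen_F d) (pi_star_sum Q)"
  by (simp add: mac_Psi_def ce_Phi_def pi_star_sum_def pi_star_sum_of pi_star_mult pi_star_mac_P)

section \<open>The coefficient field and the graded pieces over it\<close>

lemma upoly_vars_add: "upoly_vars (p + q) \<subseteq> upoly_vars p \<union> upoly_vars q"
  using Poly_Mapping.keys_add[of p q] by (auto simp: upoly_vars_def)

lemma upoly_vars_mult: "upoly_vars (p * q) \<subseteq> upoly_vars p \<union> upoly_vars q"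
proof
  fix x assume "x \<in> upoly_vars (p * q)"
  then obtain e where "e \<in> Poly_Mapping.keys (p * q)" and x: "x \<in> Poly_Mapping.keys e"
    by (auto simp: upoly_vars_def)
  then obtain a b where "a \<in> Poly_Mapping.keys p" "b \<in> Poly_Mapping.keys q" "e = a + b"
    using keys_mult[of p q] by blast
  then show "x \<in> upoly_vars p \<union> upoly_vars q"
    using x Poly_Mapping.keys_add[of a b] by (auto simp: upoly_vars_def)
qed

lemma Kfield_iff:
  "k \<in> Kfield d \<longleftrightarrow> (\<exists>p q. k = Fract p q \<and> q \<noteq> 0 \<and>
     upoly_vars p \<union> upoly_vars q \<subseteq> {u_index i c | i c. vsum c = d $ i})"
  by (auto simp: Kfield_def Let_def)

lemma Kfield_add:
  assumes "x \<in> Kfield d" "y \<in> Kfield d"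
  shows "x + y \<in> Kfield d"
proof -
  let ?U = "{u_index i c | i c. vsum c = d $ i}"
  obtain p q r s where "x = Fract p q" "q \<noteq> 0" "upoly_vars p \<union> upoly_vars q \<subseteq> ?U"
    "y = Fract r s" "s \<noteq> 0" "upoly_vars r \<union> upoly_vars s \<subseteq> ?U"
    using assms unfolding Kfield_iff by blast
  then show ?thesis
    unfolding Kfield_iff
    using upoly_vars_add[of "p * s" "r * q"] upoly_vars_mult[of p s] upoly_vars_mult[of r q]
      upoly_vars_mult[of q s]
    by (intro exI[of _ "p * s + r * q"] exI[of _ "q * s"]) (simp, blast)
qed

lemma Kfield_mult:
  assumes "x \<in> Kfield d" "y \<in> Kfield d"
  shows "x * y \<in> Kfield d"
proof -
  let ?U = "{u_index i c | i c. vsum c = d $ i}"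
  obtain p q r s where "x = Fract p q" "q \<noteq> 0" "upoly_vars p \<union> upoly_vars q \<subseteq> ?U"
    "y = Fract r s" "s \<noteq> 0" "upoly_vars r \<union> upoly_vars s \<subseteq> ?U"
    using assms unfolding Kfield_iff by blast
  then show ?thesis
    unfolding Kfield_iff using upoly_vars_mult[of p r] upoly_vars_mult[of q s]
    by (intro exI[of _ "p * r"] exI[of _ "q * s"]) (simp, blast)
qed

lemma upoly_vars_const [simp]: "upoly_vars 0 = {}" "upoly_vars 1 = {}"
  by (auto simp: upoly_vars_def)

lemma Kfield_0: "0 \<in> Kfield d"
  unfolding Kfield_iff by (intro exI[of _ 0] exI[of _ 1]) (simp add: Zero_fract_def)

lemma Kfield_1: "1 \<in> Kfield d"
  unfolding Kfield_iff by (intro exI[of _ 1]) (simp add: One_fract_def)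

lemma Kfield_uvar:
  assumes "vsum c = d $ i"
  shows "uvar i c \<in> Kfield d"
  unfolding Kfield_iff uvar_def
  by (intro exI[of _ "Poly_Mapping.single (Poly_Mapping.single (u_index i c) 1) 1"] exI[of _ 1])
    (use assms in \<open>auto simp: upoly_vars_def\<close>)

lemma homog_part_0: "0 \<in> homog_part d e"
  by (simp add: homog_part_def Kfield_0)

lemma homog_part_single:
  assumes "k \<in> Kfield d" "vsum c = e"
  shows "Poly_Mapping.single c k \<in> homog_part d e"
  using assms by (auto simp: homog_part_def lookup_single when_def Kfield_0)

lemma homog_part_add:
  assumes "P \<in> homog_part d e" "Q \<in> homog_part d e"
  shows "P + Q \<in> homog_part d e"
  using assms Poly_Mapping.keys_add[of P Q] by (auto simp: homog_part_def lookup_add Kfield_add)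

lemma homog_part_sum:
  "(\<And>x. x \<in> X \<Longrightarrow> f x \<in> homog_part d e) \<Longrightarrow> sum f X \<in> homog_part d e"
  by (induction X rule: infinite_finite_induct) (auto simp: homog_part_0 homog_part_add)

lemma homog_part_mult:
  assumes "P \<in> homog_part d e" "Q \<in> homog_part d e'"
  shows "P * Q \<in> homog_part d (e + e')"
proof -
  have "P * Q = (\<Sum>c\<in>Poly_Mapping.keys P. \<Sum>c'\<in>Poly_Mapping.keys Q.
      Poly_Mapping.single (c + c') (Poly_Mapping.lookup P c * Poly_Mapping.lookup Q c'))"
    by (subst sum_single_keys[of P, symmetric], subst sum_single_keys[of Q, symmetric])
      (simp add: sum_product mult_single)
  also have "\<dots> \<in> homog_part d (e + e')"
    using assms by (intro homog_part_sum homog_part_single Kfield_mult)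
      (auto simp: homog_part_def vsum_add)
  finally show ?thesis .
qed

lemma mac_P_homog: "mac_P d i \<in> homog_part d (d $ i)"
  unfolding mac_P_def by (intro homog_part_sum homog_part_single Kfield_uvar) auto

lemma deg_in_less_iff:
  assumes "0 < e"
  shows "deg_in j Q < e \<longleftrightarrow> (\<forall>c\<in>Poly_Mapping.keys Q. c $ j < e)"
  using assms by (auto simp: deg_in_def)


section \<open>Homogeneous coordinates on the simplices\<close>

definition hom_coords :: "real \<Rightarrow> 'i rvec \<Rightarrow> 'i::{finite,linorder} rvec" where
  "hom_coords e x = (\<chi> j. if j = ix0 then e - vsum x else x $ j)"

lemma vsum_hom_coords:
  assumes "x \<in> coords1n"
  shows "vsum (hom_coords e x) = e"
  using assms by (simp add: vsum_split hom_coords_def coords1n_def)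

lemma hom_coords_le:
  assumes "x \<in> coords1n" "\<And>j. 0 \<le> hom_coords e x $ j"
  shows "hom_coords e x $ j \<le> e"
proof -
  have "hom_coords e x $ j \<le> vsum (hom_coords e x)"
    unfolding vsum_def using assms(2) by (intro member_le_sum) auto
  then show ?thesis by (simp add: vsum_hom_coords[OF assms(1)])
qed

lemma vsum_sum: "vsum (\<Sum>i\<in>I. x i) = (\<Sum>i\<in>I. vsum (x i))"
  unfolding vsum_def sum_component by (rule sum.swap)

lemma hom_coords_sum:
  "hom_coords (\<Sum>i\<in>I. e i) (\<Sum>i\<in>I. x i) $ j = (\<Sum>i\<in>I. hom_coords (e i) (x i) $ j)"
  by (simp add: hom_coords_def vsum_sum sum_subtractf)

lemma vsum_scaleR: "vsum (a *\<^sub>R x) = a * vsum x" for x :: "'i::finite rvec"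
  by (simp add: vsum_def sum_distrib_left)

lemma hom_coords_scaleR: "hom_coords (a * e) (a *\<^sub>R x) $ j = a * hom_coords e x $ j"
  by (simp add: hom_coords_def vsum_scaleR right_diff_distrib)

lemma hom_coords_affine:
  assumes "u + w = 1"
  shows "hom_coords e (u *\<^sub>R x + w *\<^sub>R y) $ j = u * hom_coords e x $ j + w * hom_coords e y $ j"
proof -
  have "u * e + w * e = e" using assms by (simp flip: distrib_right)
  then show ?thesis by (simp add: hom_coords_def vsum_scaleR vsum_add right_diff_distrib)
qed

lemma rvec_of_in_coords1n: "a \<in> coords1n \<Longrightarrow> rvec_of a \<in> coords1n"
  by (simp add: coords1n_def rvec_of_def)

lemma vsum_rvec_of: "vsum (rvec_of a) = real_of_int (vsum a)"
  by (simp add: vsum_def rvec_of_def)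

lemma rvec_of_inj: "rvec_of a = rvec_of b \<longleftrightarrow> a = b"
  by (simp add: vec_eq_iff rvec_of_def)

lemma hom_coords_dehomogenize:
  "hom_coords e (rvec_of (dehomogenize c)) $ j =
     (if j = ix0 then e - real (vsum c) + real (c $ ix0) else real (c $ j))"
  by (simp add: hom_coords_def vsum_rvec_of vsum_dehomogenize)
    (simp add: rvec_of_def dehomogenize_def)

text \<open>The vertex \<open>e e\<^sub>i\<close> of the simplex of size \<open>e\<close>, where \<open>e\<^sub>i\<close> is the origin if \<open>i\<close> is the least
  index.\<close>

definition corner :: "nat \<Rightarrow> 'i \<Rightarrow> 'i::{finite,linorder} rvec" where
  "corner e i = rvec_of (dehomogenize (axis i e))"

lemma corner_nth: "corner e i $ j = (if i = j \<and> j \<noteq> ix0 then real e else 0)"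
  by (simp add: corner_def rvec_of_def dehomogenize_def axis_def)

lemma corner_in_coords1n: "corner e i \<in> coords1n"
  by (simp add: coords1n_def corner_nth)

lemma hom_coords_corner: "hom_coords (real e) (corner e i) $ j = (if i = j then real e else 0)"
  unfolding corner_def hom_coords_dehomogenize vsum_axis by (cases "i = j"; cases "j = ix0") (auto simp: axis_def)

lemma hom_coords_eqI:
  assumes "x \<in> coords1n" "y \<in> coords1n" "\<And>j. hom_coords e x $ j = hom_coords e y $ j"
  shows "x = y"
  unfolding vec_eq_iff
proof
  fix j show "x $ j = y $ j"
    using assms(1,2) assms(3)[of j] by (cases "j = ix0") (auto simp: coords1n_def hom_coords_def)
qed

lemma supp_A_eq: "supp_A d i = dehomogenize ` {c. vsum c = d $ i}"
  unfolding supp_A_def by (rule bij_betw_imp_surj_on[OF bij_betw_dehomogenize, symmetric])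

text \<open>The homogeneous coordinates, divided by \<open>d\<^sub>i\<close>, are the barycentric coordinates with
  respect to the vertices of the simplex.\<close>

lemma polytope_D_iff:
  assumes "0 < d $ i"
  shows "x \<in> polytope_D d i \<longleftrightarrow> x \<in> coords1n \<and> (\<forall>j. 0 \<le> hom_coords (real (d $ i)) x $ j)"
proof
  let ?S = "{x. x \<in> coords1n \<and> (\<forall>j. 0 \<le> hom_coords (real (d $ i)) x $ j)}"
  assume "x \<in> polytope_D d i"
  moreover have "rvec_of ` supp_A d i \<subseteq> ?S"
    by (auto simp: supp_A_eq hom_coords_dehomogenize rvec_of_in_coords1n dehomogenize_in_coords1n)
  moreover have "convex ?S"
    by (auto simp: convex_def hom_coords_affine subspace_coords1n subspace_add subspace_scale)
  ultimately show "x \<in> coords1n \<and> (\<forall>j. 0 \<le> hom_coords (real (d $ i)) x $ j)"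
    unfolding polytope_D_def using hull_minimal[of "rvec_of ` supp_A d i" ?S convex] by auto
next
  assume x: "x \<in> coords1n \<and> (\<forall>j. 0 \<le> hom_coords (real (d $ i)) x $ j)"
  define h where "h j = hom_coords (real (d $ i)) x $ j / real (d $ i)" for j
  have "(\<Sum>j\<in>UNIV. h j *\<^sub>R corner (d $ i) j) \<in> polytope_D d i"
  proof (rule convex_sum)
    show "sum h UNIV = 1"
      using assms vsum_hom_coords[of x "real (d $ i)"] x
      by (simp add: h_def vsum_def flip: sum_divide_distrib)
    show "corner (d $ i) j \<in> polytope_D d i" for j
      unfolding polytope_D_def corner_def supp_A_eq by (intro hull_inc imageI) simp
  qed (use x in \<open>auto simp: h_def polytope_D_def\<close>)
  moreover have "(\<Sum>j\<in>UNIV. h j *\<^sub>R corner (d $ i) j) = x"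
    unfolding vec_eq_iff
  proof
    fix k
    have "(\<Sum>j\<in>UNIV. h j *\<^sub>R corner (d $ i) j) $ k =
        (\<Sum>j\<in>UNIV. if j = k then (if k = ix0 then 0 else h k * real (d $ i)) else 0)"
      unfolding sum_component by (intro sum.cong refl) (auto simp: corner_nth)
    also have "\<dots> = x $ k"
      using x assms by (auto simp: h_def hom_coords_def coords1n_def)
    finally show "(\<Sum>j\<in>UNIV. h j *\<^sub>R corner (d $ i) j) $ k = x $ k" .
  qed
  ultimately show "x \<in> polytope_D d i" by simp
qed

text \<open>All the simplices are dilates of the standard one, so a point of the large simplex
  decomposes into its multiples by \<open>d\<^sub>i / |d|\<close>.\<close>

lemma mink_sum_polytope_D_iff:
  assumes d: "\<And>i. 0 < d $ i"
  shows "x \<in> mink_sum (polytope_D d) \<longleftrightarrow>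
    x \<in> coords1n \<and> (\<forall>j. 0 \<le> hom_coords (real (vsum d)) x $ j)"
proof
  have vd: "real (vsum d) = (\<Sum>i\<in>UNIV. real (d $ i))" by (simp add: vsum_def)
  assume "x \<in> mink_sum (polytope_D d)"
  then obtain y where y: "\<And>i. y i \<in> polytope_D d i" "x = sum y UNIV"
    by (auto simp: mink_sum_def)
  then have "x \<in> coords1n"
    using d by (auto simp: polytope_D_iff intro!: subspace_sum subspace_coords1n)
  moreover have "0 \<le> hom_coords (real (vsum d)) x $ j" for j
    unfolding y(2) vd hom_coords_sum using y(1) d by (auto simp: polytope_D_iff intro!: sum_nonneg)
  ultimately show "x \<in> coords1n \<and> (\<forall>j. 0 \<le> hom_coords (real (vsum d)) x $ j)" by simp
next
  assume x: "x \<in> coords1n \<and> (\<forall>j. 0 \<le> hom_coords (real (vsum d)) x $ j)"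
  have pos: "0 < vsum d" using d nth_le_vsum[of d ix0] by (meson order_less_le_trans)
  define y where "y i = (real (d $ i) / real (vsum d)) *\<^sub>R x" for i
  have "hom_coords (real (d $ i)) (y i) $ j =
      real (d $ i) / real (vsum d) * hom_coords (real (vsum d)) x $ j" for i j
    using hom_coords_scaleR[of "real (d $ i) / real (vsum d)" "real (vsum d)" x j] pos
    by (simp add: y_def)
  then have "y i \<in> polytope_D d i" for i
    using x d by (simp add: polytope_D_iff) (simp add: y_def subspace_coords1n subspace_scale)
  moreover have "sum y UNIV = x"
  proof -
    have "sum y UNIV = (\<Sum>i\<in>UNIV. real (d $ i) / real (vsum d)) *\<^sub>R x"
      by (simp add: y_def scaleR_left.sum)
    also have "(\<Sum>i\<in>UNIV. real (d $ i) / real (vsum d)) = real (vsum d) / real (vsum d)"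
      by (subst sum_divide_distrib[symmetric]) (simp add: vsum_def)
    finally show ?thesis using pos by simp
  qed
  ultimately show "x \<in> mink_sum (polytope_D d)" unfolding mink_sum_def by blast
qed

lemma finite_supp_A: "finite (supp_A d i)"
  by (simp add: supp_A_eq finite_vsum_eq)

lemma compact_polytope_D: "compact (polytope_D d i)"
  unfolding polytope_D_def by (intro compact_convex_hull finite_imp_compact finite_imageI finite_supp_A)

lemma supp_A_nonempty: "supp_A d i \<noteq> {}"
  by (auto simp: supp_A_eq intro: exI[of _ "axis i (d $ i)"])

lemma polytope_D_nonempty: "polytope_D d i \<noteq> {}"
  using supp_A_nonempty by (simp add: polytope_D_def)

section \<open>Components of the cells of the coarse subdivision\<close>

lemma phi_eq: "phi d k x = real (d $ k) - hom_coords (real (d $ k)) x $ k"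
  by (simp add: phi_def hom_coords_def)

lemma phi_affine:
  assumes "u + w = 1"
  shows "phi d k (u *\<^sub>R x + w *\<^sub>R y) = u * phi d k x + w * phi d k y"
proof -
  have "u * real (d $ k) + w * real (d $ k) = real (d $ k)"
    using assms by (simp flip: distrib_right)
  then show ?thesis by (simp add: phi_eq hom_coords_affine[OF assms] right_diff_distrib)
qed

lemma continuous_on_phi: "continuous_on S (phi d k)"
  unfolding phi_def[abs_def] vsum_def by (cases "k = ix0") (auto intro!: continuous_intros)

text \<open>If \<open>x\<close> minimizes \<open>\<phi>\<^sub>k + w\<close> on \<open>\<Delta>\<^sub>k\<close> and has mass at the index \<open>j\<close>, then moving this mass to the
  index \<open>l\<close> cannot lower the value, so the coefficient at \<open>j\<close> is at most that at \<open>l\<close>.\<close>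

lemma phi_cell_exchange:
  assumes d: "0 < d $ k" and w: "w \<in> coords1n" and x: "x \<in> cell (polytope_D d k) (phi d k) w"
    and pos: "0 < hom_coords (real (d $ k)) x $ j"
  shows "w $ j - (if j = k then 1 else 0) \<le> w $ l - (if l = k then 1 else 0)"
proof (cases "j = l")
  case False
  let ?H = "hom_coords (real (d $ k))"
  define h where "h = ?H x $ j"
  define y where "y = x + h *\<^sub>R (corner 1 l - corner 1 j)"
  have x': "x \<in> polytope_D d k" "\<And>y. y \<in> polytope_D d k \<Longrightarrow> phi d k x + w \<bullet> x \<le> phi d k y + w \<bullet> y"
    using x by (auto simp: cell_def)
  have "hom_coords 0 (corner 1 l - corner 1 j) $ i =
      (if i = l then 1 else 0) - (if i = j then 1 else 0)" for i
    using hom_coords_corner[of 1 l i] hom_coords_corner[of 1 j i]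
    by (auto simp: hom_coords_def vsum_def sum_subtractf)
  moreover have "?H y $ i = ?H x $ i + h * hom_coords 0 (corner 1 l - corner 1 j) $ i" for i
    by (simp add: hom_coords_def y_def vsum_add vsum_scaleR)
  ultimately have Hy: "?H y $ i = ?H x $ i + h * ((if i = l then 1 else 0) - (if i = j then 1 else 0))" for i
    by simp
  have "y \<in> polytope_D d k"
    using x' d pos False
    by (auto simp: polytope_D_iff Hy h_def) (auto simp: y_def subspace_coords1n subspace_add
        subspace_scale subspace_diff corner_in_coords1n)
  then have "phi d k x + w \<bullet> x \<le> phi d k y + w \<bullet> y" by (rule x'(2))
  moreover have "w \<bullet> corner 1 i = w $ i" for i
  proof -
    have "w \<bullet> corner 1 i = (\<Sum>j\<in>UNIV. if j = i then w $ i else 0)"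
      unfolding inner_vec_def using w by (intro sum.cong) (auto simp: corner_nth coords1n_def)
    then show ?thesis by simp
  qed
  then have "w \<bullet> y = w \<bullet> x + h * (w $ l - w $ j)"
    by (simp add: y_def inner_add_right inner_diff_right)
  moreover have "phi d k y = phi d k x - h * ((if k = l then 1 else 0) - (if k = j then 1 else 0))"
    by (simp add: phi_eq Hy)
  ultimately have "0 \<le> h * ((w $ l - (if l = k then 1 else 0)) - (w $ j - (if j = k then 1 else 0)))"
    by (simp add: algebra_simps split: if_splits)
  then show ?thesis using pos by (simp add: h_def zero_le_mult_iff)
qed simp

text \<open>The two cases are \<open>w\<^sub>i < w\<^sub>z + 1\<close> and \<open>w\<^sub>i \<ge> w\<^sub>z + 1\<close>, where \<open>w\<^sub>z\<close> is the smallest coordinate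
  of \<open>w\<close>. In the first, mass at any \<open>j \<noteq> i\<close> in the \<open>i\<close>-th simplex would be better placed at \<open>i\<close>. In
  the second, mass at \<open>i\<close> in the \<open>k\<close>-th simplex with \<open>k \<noteq> i\<close> would be better placed at \<open>z\<close>, so the whole
  \<open>i\<close>-th coordinate of \<open>p\<close> comes from the \<open>i\<close>-th summand.\<close>

lemma phi_component_dichotomy:
  assumes d: "\<And>k. 0 < d $ k" and w: "w \<in> coords1n"
    and x: "\<And>k. x k \<in> cell (polytope_D d k) (phi d k) w"
    and p: "p = sum x UNIV"
  shows "cell (polytope_D d i) (phi d i) w = {corner (d $ i) i} \<or>
    hom_coords (real (vsum d)) p $ i = hom_coords (real (d $ i)) (x i) $ i"
proof -
  have xD: "x k \<in> polytope_D d k" for k using x by (auto simp: cell_def)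
  have "Min (range (($) w)) \<in> range (($) w)"
    by (rule Min_in) auto
  then obtain z where "w $ z = Min (range (($) w))"
    by (auto simp: image_iff)
  then have z: "w $ z \<le> w $ l" for l
    by simp
  note ex = phi_cell_exchange[OF d w]
  show ?thesis
  proof (cases "w $ i < w $ z + 1")
    case True
    have "y = corner (d $ i) i" if y: "y \<in> cell (polytope_D d i) (phi d i) w" for y
    proof (rule hom_coords_eqI[of _ _ "real (d $ i)"])
      have yD: "y \<in> coords1n" "\<And>j. 0 \<le> hom_coords (real (d $ i)) y $ j"
        using y polytope_D_iff[OF d] by (auto simp: cell_def)
      have 0: "hom_coords (real (d $ i)) y $ j = 0" if "j \<noteq> i" for j
      proof (rule ccontr)
        assume "hom_coords (real (d $ i)) y $ j \<noteq> 0"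
        then have "0 < hom_coords (real (d $ i)) y $ j" using yD(2)[of j] by simp
        from ex[OF y this, of i] that True z[of j] show False by simp
      qed
      have "hom_coords (real (d $ i)) y $ i = vsum (hom_coords (real (d $ i)) y)"
        unfolding vsum_def by (subst sum.remove[of _ i]) (auto simp: 0)
      then show "hom_coords (real (d $ i)) y $ j = hom_coords (real (d $ i)) (corner (d $ i) i) $ j" for j
        using 0[of j] vsum_hom_coords[OF yD(1)] by (auto simp: hom_coords_corner)
      show "y \<in> coords1n" by (rule yD)
    qed (rule corner_in_coords1n)
    then have "cell (polytope_D d i) (phi d i) w \<subseteq> {corner (d $ i) i}"
      by auto
    then show ?thesis using x[of i] by (auto dest: subset_singletonD)
  next
    case False
    have "hom_coords (real (d $ k)) (x k) $ i = 0" if "k \<noteq> i" for k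
    proof (rule ccontr)
      assume "hom_coords (real (d $ k)) (x k) $ i \<noteq> 0"
      then have "0 < hom_coords (real (d $ k)) (x k) $ i"
        using xD[of k] by (simp add: polytope_D_iff[OF d] order_less_le)
      from ex[OF x this, of z] that False show False by (auto split: if_splits)
    qed
    then have "(\<Sum>k\<in>UNIV. hom_coords (real (d $ k)) (x k) $ i) = hom_coords (real (d $ i)) (x i) $ i"
      by (subst sum.remove[of _ i]) auto
    then show ?thesis
      by (simp add: p vsum_def flip: hom_coords_sum)
  qed
qed


section \<open>Macaulay exponents of the critical degree\<close>

lemma ndim_less_vsum:
  fixes d :: "'i::{finite,linorder} nvec"
  assumes "\<And>i. 0 < d $ i"
  shows "ndim TYPE('i) < vsum d"
proof -
  have "card (UNIV :: 'i set) \<le> vsum d"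
    unfolding vsum_def card_eq_sum using assms by (intro sum_mono) (simp add: Suc_leI)
  moreover have "0 < card (UNIV :: 'i set)"
    by simp
  ultimately show ?thesis unfolding ndim_def by linarith
qed

lemma degree_le_mac_deg:
  fixes d :: "'i::{finite,linorder} nvec"
  assumes "\<And>i. 0 < d $ i"
  shows "d $ i \<le> mac_deg d"
proof -
  have "card (UNIV - {i}) \<le> (\<Sum>j\<in>UNIV - {i}. d $ j)"
    unfolding card_eq_sum using assms by (intro sum_mono) (simp add: Suc_leI)
  then show ?thesis
    by (simp add: mac_deg_def ndim_def vsum_def sum.remove[of UNIV i])
qed

text \<open>Pigeonhole: if \<open>c\<^sub>i \<le> d\<^sub>i - 1\<close> for all \<open>n + 1\<close> indices, then \<open>|c| \<le> |d| - n - 1\<close>.\<close>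

lemma mac_I_exceeds:
  fixes d :: "'i::{finite,linorder} nvec"
  assumes "\<And>i. 0 < d $ i" "c \<in> mac_I d"
  shows "\<exists>i. d $ i \<le> c $ i"
proof (rule ccontr)
  assume "\<not> ?thesis"
  then have "vsum c + card (UNIV :: 'i set) \<le> vsum d"
    unfolding vsum_def card_eq_sum sum.distrib[symmetric]
    by (intro sum_mono) (simp add: not_le Suc_leI)
  moreover have "vsum c = vsum d - (card (UNIV :: 'i set) - 1)"
    using assms(2) by (simp add: mac_I_def mac_deg_def ndim_def)
  moreover have "0 < card (UNIV :: 'i set)"
    by simp
  ultimately show False by linarith
qed

section \<open>The shifted lattice points and their cells\<close>

locale macaulay_subdivision =
  fixes d :: "'i::{finite,linorder} nvec"
    and \<mu> \<rho> :: "'i \<Rightarrow> 'i rvec \<Rightarrow> real"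
    and \<delta> :: "'i rvec"
  assumes d_pos: "\<And>i. 0 < d $ i"
    and mu_linear: "\<And>i. linear (\<mu> i)"
    and rho_eq: "\<And>i x. \<rho> i x = phi d i x + \<mu> i x"
    and tight: "tight_subdiv (polytope_D d) \<rho>"
    and refines: "subdiv_refines (polytope_D d) \<rho> (phi d)"
    and delta_in: "\<delta> \<in> coords1n"
    and delta_pos: "\<And>i. i \<noteq> ix0 \<Longrightarrow> 0 < \<delta> $ i + 1"
    and delta_sum: "(\<Sum>i\<in>UNIV - {ix0}. (\<delta> $ i + 1)) < 1"
    and generic: "generic_shift (polytope_D d) \<rho> \<delta>"
begin

abbreviation \<Delta> where "\<Delta> \<equiv> polytope_D d"

text \<open>The homogeneous coordinates of \<open>-\<delta>\<close>, with respect to the size \<open>|d| - m = n\<close>.\<close>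

definition excess :: "'i \<Rightarrow> real" where
  "excess j = (if j = ix0 then (\<Sum>i\<in>UNIV - {ix0}. (\<delta> $ i + 1)) else - (\<delta> $ j))"

lemma vsum_delta: "vsum \<delta> = (\<Sum>i\<in>UNIV - {ix0}. (\<delta> $ i + 1)) - real (ndim TYPE('i))"
  using delta_in by (simp add: vsum_split coords1n_def sum.distrib ndim_def)

text \<open>For \<open>n = 0\<close> the only excess is the empty sum \<open>0\<close>; strict positivity needs a coordinate
  other than \<open>ix0\<close>.\<close>

lemma
  shows excess_nonneg: "0 \<le> excess j" and excess_less_1: "excess j < 1"
    and excess_pos: "UNIV \<noteq> {ix0 :: 'i} \<Longrightarrow> 0 < excess j"
proof -
  have le: "\<delta> $ i + 1 \<le> (\<Sum>i\<in>UNIV - {ix0}. (\<delta> $ i + 1))" if "i \<noteq> ix0" for i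
    using that delta_pos by (intro member_le_sum) (auto simp: less_imp_le)
  show "excess j < 1"
    using delta_sum delta_pos[of j] by (auto simp: excess_def)
  show pos: "0 < excess j" if "UNIV \<noteq> {ix0 :: 'i}"
  proof (cases "j = ix0")
    case True
    have "0 < (\<Sum>i\<in>UNIV - {ix0 :: 'i}. (\<delta> $ i + 1))"
      using that delta_pos by (intro sum_pos) auto
    then show ?thesis using True by (simp add: excess_def)
  next
    case False
    then show ?thesis using le[of j] delta_sum by (simp add: excess_def)
  qed
  show "0 \<le> excess j"
  proof (cases "UNIV = {ix0 :: 'i}")
    case True
    then have "j = ix0" by auto
    then show ?thesis by (simp add: excess_def True)
  qed (use pos in \<open>simp add: less_imp_le\<close>)
qed

lemma hom_coords_unshift:
  fixes b :: "'i zvec"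
  shows "hom_coords (real (vsum d)) (rvec_of b - \<delta>) $ j =
    of_int (if j = ix0 then int (mac_deg d) - vsum b else b $ j) + excess j"
proof -
  have "real (mac_deg d) = real (vsum d) - real (ndim TYPE('i))"
    using ndim_less_vsum[OF d_pos] by (simp add: mac_deg_def of_nat_diff)
  moreover have "vsum (rvec_of b - \<delta>) = of_int (vsum b) - vsum \<delta>"
    by (simp add: vsum_rvec_of[symmetric]) (simp add: vsum_def sum_subtractf)
  ultimately show ?thesis
    by (simp add: hom_coords_def excess_def vsum_delta) (simp add: rvec_of_def)
qed

lemma unshift_in_coords1n:
  "b \<in> coords1n \<Longrightarrow> rvec_of b - \<delta> \<in> coords1n"
  by (simp add: delta_in rvec_of_in_coords1n subspace_coords1n subspace_diff)

text \<open>As the excesses are in \<open>[0, 1)\<close>, the shifted point has nonnegative homogeneous coordinates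
  if and only if the integral ones are nonnegative.\<close>

lemma ce_B_eq: "ce_B \<Delta> \<delta> = {b \<in> coords1n. (\<forall>j. 0 \<le> b $ j) \<and> vsum b \<le> int (mac_deg d)}"
proof -
  have floor: "0 \<le> of_int k + excess j \<longleftrightarrow> 0 \<le> k" for k :: int and j
    using excess_nonneg[of j] excess_less_1[of j] by linarith
  have "rvec_of b \<in> (+) \<delta> ` mink_sum \<Delta> \<longleftrightarrow> (\<forall>j. 0 \<le> b $ j) \<and> vsum b \<le> int (mac_deg d)"
    if b: "b \<in> coords1n" for b
  proof -
    have "rvec_of b \<in> (+) \<delta> ` mink_sum \<Delta> \<longleftrightarrow> rvec_of b - \<delta> \<in> mink_sum \<Delta>"
      by (auto simp: image_iff) (metis add_diff_cancel_left' diff_add_cancel add.commute)+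
    also have "\<dots> \<longleftrightarrow> (\<forall>j. 0 \<le> (if j = ix0 then int (mac_deg d) - vsum b else b $ j))"
      unfolding mink_sum_polytope_D_iff[OF d_pos] hom_coords_unshift floor
      using unshift_in_coords1n[OF b] by simp
    also have "\<dots> \<longleftrightarrow> (\<forall>j. 0 \<le> b $ j) \<and> vsum b \<le> int (mac_deg d)"
    proof (intro iffI conjI allI)
      assume *: "\<forall>j. 0 \<le> (if j = ix0 then int (mac_deg d) - vsum b else b $ j)"
      show "0 \<le> b $ j" for j
        using *[rule_format, of j] b by (cases "j = ix0") (auto simp: coords1n_def)
      show "vsum b \<le> int (mac_deg d)"
        using *[rule_format, of ix0] by simp
    qed auto
    finally show ?thesis .
  qed
  then show ?thesis unfolding ce_B_def by (intro Collect_cong conj_cong refl)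
qed

lemma bij_betw_mac_I_ce_B: "bij_betw dehomogenize (mac_I d) (ce_B \<Delta> \<delta>)"
  unfolding ce_B_eq mac_I_def by (rule bij_betw_dehomogenize)

definition unshifted :: "'i nvec \<Rightarrow> 'i rvec" where
  "unshifted c = rvec_of (dehomogenize c) - \<delta>"

lemma unshifted_in_coords1n: "unshifted c \<in> coords1n"
  by (simp add: unshifted_def unshift_in_coords1n dehomogenize_in_coords1n)

lemma hom_coords_unshifted:
  assumes "c \<in> mac_I d"
  shows "hom_coords (real (vsum d)) (unshifted c) $ j = real (c $ j) + excess j"
  using assms unfolding unshifted_def hom_coords_unshift vsum_dehomogenize mac_I_def
  by (simp add: dehomogenize_def)

lemma hom_coords_unshifted_pos:
  assumes "c \<in> mac_I d"
  shows "0 < hom_coords (real (vsum d)) (unshifted c) $ j"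
proof (cases "UNIV = {ix0 :: 'i}")
  case True
  obtain i where i: "d $ i \<le> c $ i" using mac_I_exceeds[OF d_pos assms] by blast
  have "i = j" using True by (metis UNIV_I singletonD)
  moreover have "0 < c $ i" using i d_pos[of i] by linarith
  ultimately have "0 < c $ j" by simp
  then show ?thesis using excess_nonneg[of j] by (simp add: hom_coords_unshifted[OF assms])
next
  case False
  then show ?thesis using excess_pos[of j] by (simp add: hom_coords_unshifted[OF assms])
qed

lemma rho_affine:
  assumes "u + w = 1"
  shows "\<rho> i (u *\<^sub>R x + w *\<^sub>R y) = u * \<rho> i x + w * \<rho> i y"
  by (simp add: rho_eq phi_affine[OF assms] linear_add[OF mu_linear] linear_scale[OF mu_linear]
      distrib_left)

lemma continuous_on_rho: "continuous_on S (\<rho> i)"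
proof -
  have "\<rho> i = (\<lambda>x. phi d i x + \<mu> i x)" by (simp add: fun_eq_iff rho_eq)
  moreover have "continuous_on S (\<mu> i)"
    using mu_linear by (simp add: linear_conv_bounded_linear linear_continuous_on)
  ultimately show ?thesis by (simp add: continuous_on_add continuous_on_phi)
qed

lemma convex_polytope_D: "convex (\<Delta> i)"
  by (simp add: polytope_D_def)

lemma convex_on_rho: "convex_on (\<Delta> i) (\<rho> i)"
  by (simp add: convex_on_def convex_polytope_D rho_affine)

lemma polytope_D_subset: "\<Delta> i \<subseteq> coords1n"
  using polytope_D_iff[OF d_pos] by blast

text \<open>All homogeneous coordinates of the point are positive, and those of any \<open>y\<close> are at most
  \<open>|d|\<close>; this determines how far the segment from \<open>y\<close> can be prolonged.\<close>

lemma unshifted_interior: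
  assumes c: "c \<in> mac_I d" and y: "y \<in> mink_sum \<Delta>"
  shows "\<exists>e>0. unshifted c + e *\<^sub>R (unshifted c - y) \<in> mink_sum \<Delta>"
proof -
  let ?H = "hom_coords (real (vsum d))" and ?p = "unshifted c"
  have N: "0 < real (vsum d)" using ndim_less_vsum[OF d_pos] by linarith
  have yH: "y \<in> coords1n" "\<And>j. 0 \<le> ?H y $ j"
    using y mink_sum_polytope_D_iff[OF d_pos] by auto
  define e where "e = Min (range (\<lambda>j. ?H ?p $ j / real (vsum d)))"
  have "e \<in> range (\<lambda>j. ?H ?p $ j / real (vsum d))"
    unfolding e_def by (rule Min_in) auto
  then have e: "0 < e"
    using hom_coords_unshifted_pos[OF c] N by auto
  have "0 \<le> ?H (?p + e *\<^sub>R (?p - y)) $ j" for j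
  proof -
    have "?p + e *\<^sub>R (?p - y) = (1 + e) *\<^sub>R ?p + (- e) *\<^sub>R y"
      by (simp add: algebra_simps)
    then have "?H (?p + e *\<^sub>R (?p - y)) $ j = ?H ?p $ j + e * ?H ?p $ j - e * ?H y $ j"
      using hom_coords_affine[of "1 + e" "- e" "real (vsum d)" ?p y j] by (simp add: algebra_simps)
    moreover have "e * ?H y $ j \<le> e * real (vsum d)"
      using hom_coords_le[OF yH] e by (intro mult_left_mono) auto
    moreover have "e \<le> ?H ?p $ j / real (vsum d)"
      unfolding e_def by (intro Min_le) auto
    then have "e * real (vsum d) \<le> ?H ?p $ j"
      using N by (simp add: pos_le_divide_eq)
    moreover have "0 \<le> e * ?H ?p $ j"
      using e hom_coords_unshifted_pos[OF c, of j] by simp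
    ultimately show ?thesis by linarith
  qed
  moreover have "?p + e *\<^sub>R (?p - y) \<in> coords1n"
    using yH(1) unshifted_in_coords1n by (intro subspace_add subspace_scale subspace_diff subspace_coords1n)
  ultimately have "?p + e *\<^sub>R (?p - y) \<in> mink_sum \<Delta>"
    by (simp add: mink_sum_polytope_D_iff[OF d_pos])
  then show ?thesis using e by blast
qed

lemma unique_ncell:
  assumes c: "c \<in> mac_I d"
  shows "\<exists>!C. C \<in> ncells \<Delta> \<rho> \<and> rvec_of (dehomogenize c) \<in> (+) \<delta> ` C"
proof (rule generic_unique_ncell[where p = "unshifted c"])
  show "unshifted c \<in> mink_sum \<Delta>"
    using hom_coords_unshifted_pos[OF c] unshifted_in_coords1n
    by (simp add: mink_sum_polytope_D_iff[OF d_pos] less_imp_le)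
qed (use unshifted_interior[OF c] in \<open>auto simp: compact_polytope_D polytope_D_subset[THEN subsetD]
    continuous_on_rho convex_on_rho generic dehomogenize_in_coords1n unshifted_def\<close>)

text \<open>An affine function on a lattice polytope attains its minimum at one of the generating
  lattice points.\<close>

lemma lattice_point_in_cell:
  obtains a where "a \<in> supp_A d i" "rvec_of a \<in> cell (\<Delta> i) (\<rho> i) v"
proof -
  let ?f = "\<lambda>x. \<rho> i x + v \<bullet> x" and ?A = "rvec_of ` supp_A d i"
  have A: "finite ?A" "?A \<noteq> {}"
    by (simp_all add: finite_supp_A supp_A_nonempty)
  then have "Min (?f ` ?A) \<in> ?f ` ?A" by (intro Min_in) auto
  then obtain a where a: "a \<in> supp_A d i" "?f (rvec_of a) = Min (?f ` ?A)" by auto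
  have "convex {x. ?f (rvec_of a) \<le> ?f x}"
    unfolding convex_def
  proof (intro ballI allI impI)
    fix x y and u w :: real
    assume xy: "x \<in> {x. ?f (rvec_of a) \<le> ?f x}" "y \<in> {x. ?f (rvec_of a) \<le> ?f x}"
      and u: "0 \<le> u" "0 \<le> w" "u + w = 1"
    have "?f (rvec_of a) = u * ?f (rvec_of a) + w * ?f (rvec_of a)"
      using u(3) by (simp flip: distrib_right)
    also have "\<dots> \<le> u * ?f x + w * ?f y"
    proof (rule add_mono)
      show "u * ?f (rvec_of a) \<le> u * ?f x" "w * ?f (rvec_of a) \<le> w * ?f y"
        using xy u by (auto intro!: mult_left_mono simp del: distrib_left)
    qed
    also have "\<dots> = ?f (u *\<^sub>R x + w *\<^sub>R y)"
      by (simp add: rho_affine[OF u(3)] inner_add_right distrib_left)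
    finally show "u *\<^sub>R x + w *\<^sub>R y \<in> {x. ?f (rvec_of a) \<le> ?f x}" by simp
  qed
  moreover have "?A \<subseteq> {x. ?f (rvec_of a) \<le> ?f x}"
    using A by (auto simp: a(2))
  ultimately have "\<Delta> i \<subseteq> {x. ?f (rvec_of a) \<le> ?f x}"
    unfolding polytope_D_def by (intro hull_minimal)
  then have "rvec_of a \<in> cell (\<Delta> i) (\<rho> i) v"
    using a(1) unfolding cell_def polytope_D_def by (auto intro: hull_inc)
  then show ?thesis using a(1) that by blast
qed

lemma component_eq:
  "component \<Delta> \<rho> (cell (mink_sum \<Delta>) (inf_conv \<Delta> \<rho>) v) i = cell (\<Delta> i) (\<rho> i) v"
  by (intro component_cell compact_polytope_D polytope_D_nonempty continuous_on_rho)

lemma ncellE: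
  assumes "C \<in> ncells \<Delta> \<rho>"
  obtains v where "C = cell (mink_sum \<Delta>) (inf_conv \<Delta> \<rho>) v"
    "\<And>i. component \<Delta> \<rho> C i = cell (\<Delta> i) (\<rho> i) v"
  using assms component_eq by (auto simp: ncells_def mixed_subdiv_def cells_def)

text \<open>The refinement places the components inside those of a cell of \<open>S(\<phi>)\<close>, to which the
  dichotomy applies. If \<open>d\<^sub>i \<le> c\<^sub>i\<close>, the second alternative would give
  \<open>c\<^sub>i < c\<^sub>i + \<epsilon>\<^sub>i \<le> d\<^sub>i\<close>. If \<open>c\<^sub>i < d\<^sub>i\<close>, the first alternative would give
  \<open>d\<^sub>i \<le> c\<^sub>i + \<epsilon>\<^sub>i < c\<^sub>i + 1\<close>; so the second holds, the point \<open>x\<^sub>i\<close> of the component has the non-integral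
  coordinate \<open>c\<^sub>i + \<epsilon>\<^sub>i\<close>, and it differs from the lattice point in the component. For \<open>n = 0\<close>
  the excess vanishes, but then the space is a single point and \<open>d\<^sub>i \<le> c\<^sub>i\<close> always holds.\<close>

lemma component_at_unshifted:
  assumes c: "c \<in> mac_I d" and C: "C \<in> ncells \<Delta> \<rho>" "unshifted c \<in> C"
  shows component_singleton: "d $ i \<le> c $ i \<Longrightarrow> component \<Delta> \<rho> C i = {corner (d $ i) i}"
    and component_positive_dim: "c $ i < d $ i \<Longrightarrow> 1 \<le> aff_dim (component \<Delta> \<rho> C i)"
proof -
  let ?H = "\<lambda>e x. hom_coords (real e) x $ i"
  obtain v where v: "C = cell (mink_sum \<Delta>) (inf_conv \<Delta> \<rho>) v"
    "\<And>i. component \<Delta> \<rho> C i = cell (\<Delta> i) (\<rho> i) v"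
    using C(1) by (rule ncellE) blast
  have "C \<in> mixed_subdiv \<Delta> \<rho>" using C(1) by (simp add: ncells_def)
  then obtain E where E: "E \<in> mixed_subdiv \<Delta> (phi d)"
    "\<And>i. component \<Delta> \<rho> C i \<subseteq> component \<Delta> (phi d) E i"
    using refines unfolding subdiv_refines_def by blast
  then obtain w where w: "w \<in> coords1n" "E = cell (mink_sum \<Delta>) (inf_conv \<Delta> (phi d)) w"
    by (auto simp: mixed_subdiv_def cells_def)
  have sub: "component \<Delta> \<rho> C k \<subseteq> cell (\<Delta> k) (phi d k) w" for k
    using E(2)[of k] component_cell[of \<Delta> "phi d" w k] unfolding w(2)
    by (simp add: compact_polytope_D polytope_D_nonempty continuous_on_phi)
  obtain x where x: "\<And>k. x k \<in> component \<Delta> \<rho> C k" "sum x UNIV = unshifted c"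
    using component_sum[of \<Delta> \<rho> "unshifted c" v] C(2) unfolding v(1)
    by (metis compact_polytope_D continuous_on_rho)
  have xE: "x k \<in> cell (\<Delta> k) (phi d k) w" for k using x sub by blast
  have xD: "x i \<in> coords1n" "\<And>j. 0 \<le> hom_coords (real (d $ i)) (x i) $ j"
    using xE[of i] polytope_D_iff[OF d_pos] by (auto simp: cell_def)
  have dich: "cell (\<Delta> i) (phi d i) w = {corner (d $ i) i} \<or> real (c $ i) + excess i = ?H (d $ i) (x i)"
    using phi_component_dichotomy[OF d_pos w(1) xE, of "unshifted c" i] x(2)
    by (simp add: hom_coords_unshifted[OF c])
  have H_corner: "?H (d $ i) (corner (d $ i) i) = real (d $ i)"
    by (simp add: hom_coords_corner)
  show "component \<Delta> \<rho> C i = {corner (d $ i) i}" if le: "d $ i \<le> c $ i"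
  proof -
    have "y = corner (d $ i) i" if y: "y \<in> component \<Delta> \<rho> C i" for y
    proof (cases "UNIV = {ix0 :: 'i}")
      case True
      have "y \<in> coords1n" using y v(2) polytope_D_subset[of i] by (auto simp: cell_def)
      then have "y $ j = corner (d $ i) i $ j" for j
        using True corner_in_coords1n[of "d $ i" i] unfolding coords1n_def
        by (metis (mono_tags, lifting) UNIV_I mem_Collect_eq singletonD)
      then show ?thesis by (simp add: vec_eq_iff)
    next
      case False
      have "?H (d $ i) (x i) \<le> real (d $ i)" by (rule hom_coords_le[OF xD])
      then have "cell (\<Delta> i) (phi d i) w = {corner (d $ i) i}"
        using dich le excess_pos[OF False, of i] by linarith
      then show ?thesis using y sub by blast
    qed
    then have "component \<Delta> \<rho> C i \<subseteq> {corner (d $ i) i}" by auto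
    then show ?thesis using x(1)[of i] by (auto dest: subset_singletonD)
  qed
  show "1 \<le> aff_dim (component \<Delta> \<rho> C i)" if less: "c $ i < d $ i"
  proof (rule ccontr)
    assume "\<not> ?thesis"
    moreover have "component \<Delta> \<rho> C i \<noteq> {}" using x(1) by blast
    then have "aff_dim (component \<Delta> \<rho> C i) \<noteq> -1" by (simp add: aff_dim_empty)
    moreover have "-1 \<le> aff_dim (component \<Delta> \<rho> C i)" by (rule aff_dim_geq)
    ultimately have "aff_dim (component \<Delta> \<rho> C i) = 0" by linarith
    then have single: "component \<Delta> \<rho> C i = {x i}"
      using x(1)[of i] by (auto simp: aff_dim_eq_0)
    have multi: "UNIV \<noteq> {ix0 :: 'i}"
    proof
      assume U: "UNIV = {ix0 :: 'i}"
      obtain j where "d $ j \<le> c $ j" using mac_I_exceeds[OF d_pos c] by blast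
      moreover have "j = i" using U by (metis UNIV_I singletonD)
      ultimately show False using less by simp
    qed
    obtain a where a: "a \<in> supp_A d i" "rvec_of a \<in> cell (\<Delta> i) (\<rho> i) v"
      by (rule lattice_point_in_cell)
    then have xa: "x i = rvec_of a" using single v(2) by auto
    obtain e where e: "a = dehomogenize e" "vsum e = d $ i" using a(1) by (auto simp: supp_A_eq)
    have H_int: "?H (d $ i) (x i) = real (e $ i)"
      unfolding xa e(1) hom_coords_dehomogenize by (simp add: e(2))
    from dich show False
    proof
      assume "cell (\<Delta> i) (phi d i) w = {corner (d $ i) i}"
      then have "x i = corner (d $ i) i" using xE[of i] by simp
      then have xi: "?H (d $ i) (x i) = real (d $ i)" using H_corner by simp
      have "?H (d $ i) (x i) \<le> hom_coords (real (vsum d)) (unshifted c) $ i"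
      proof -
        have "real (vsum d) = (\<Sum>k\<in>UNIV. real (d $ k))" by (simp add: vsum_def)
        then have "hom_coords (real (vsum d)) (unshifted c) $ i =
            (\<Sum>k\<in>UNIV. hom_coords (real (d $ k)) (x k) $ i)"
          by (simp add: hom_coords_sum flip: x(2))
        moreover have "hom_coords (real (d $ i)) (x i) $ i \<le>
            (\<Sum>k\<in>UNIV. hom_coords (real (d $ k)) (x k) $ i)"
          using xE polytope_D_iff[OF d_pos] by (intro member_le_sum) (auto simp: cell_def)
        ultimately show ?thesis by simp
      qed
      then have "real (d $ i) \<le> real (c $ i) + excess i"
        using xi by (simp add: hom_coords_unshifted[OF c])
      then show False using less excess_less_1[of i] by linarith
    next
      assume "real (c $ i) + excess i = ?H (d $ i) (x i)"
      then have "real (c $ i) + excess i = real (e $ i)" using H_int by simp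
      then have "real (c $ i) < real (e $ i)" "real (e $ i) < real (c $ i + 1)"
        using excess_pos[OF multi, of i] excess_less_1[of i] by simp_all
      then show False unfolding of_nat_less_iff by simp
    qed
  qed
qed


section \<open>The index and the vertex attached to a shifted lattice point\<close>

lemma ce_cell_at:
  assumes c: "c \<in> mac_I d"
  shows ce_cell_ncell: "ce_cell \<Delta> \<rho> \<delta> (dehomogenize c) \<in> ncells \<Delta> \<rho>"
    and unshifted_in_ce_cell: "unshifted c \<in> ce_cell \<Delta> \<rho> \<delta> (dehomogenize c)"
  using theI'[OF unique_ncell[OF c]] by (auto simp: ce_cell_def unshifted_def)

lemmas ce_component = component_at_unshifted[OF _ ce_cell_ncell unshifted_in_ce_cell]

lemma ce_index_eq:
  assumes c: "c \<in> mac_I d"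
  shows "ce_index \<Delta> \<rho> \<delta> (dehomogenize c) = Max {i. d $ i \<le> c $ i}"
proof -
  have "aff_dim (component \<Delta> \<rho> (ce_cell \<Delta> \<rho> \<delta> (dehomogenize c)) i) = 0 \<longleftrightarrow> d $ i \<le> c $ i" for i
    using ce_component[OF c c c, of i] by (cases "d $ i \<le> c $ i") auto
  then show ?thesis by (simp add: ce_index_def)
qed

lemma ce_point_eq:
  assumes c: "c \<in> mac_I d" and i: "i = ce_index \<Delta> \<rho> \<delta> (dehomogenize c)"
  shows "ce_point \<Delta> \<rho> \<delta> (dehomogenize c) = dehomogenize (axis i (d $ i))"
proof -
  have "i \<in> {i. d $ i \<le> c $ i}"
    unfolding i ce_index_eq[OF c] using mac_I_exceeds[OF d_pos c] by (intro Max_in) auto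
  then have "component \<Delta> \<rho> (ce_cell \<Delta> \<rho> \<delta> (dehomogenize c)) i = {corner (d $ i) i}"
    using ce_component(1)[OF c c c] by simp
  then show ?thesis
    unfolding ce_point_def i[symmetric] by (auto simp: corner_def rvec_of_inj intro!: the_equality)
qed

text \<open>This contains the fact that the \<open>\<I>\<^sub>i\<close> partition \<open>\<I>\<close>.\<close>

lemma mac_Ii_iff: "c \<in> mac_Ii d i \<longleftrightarrow> c \<in> mac_I d \<and> i = Max {j. d $ j \<le> c $ j}"
proof (cases "c \<in> mac_I d")
  case True
  have ne: "{j. d $ j \<le> c $ j} \<noteq> {}" using mac_I_exceeds[OF d_pos True] by auto
  have "i = Max {j. d $ j \<le> c $ j} \<longleftrightarrow> d $ i \<le> c $ i \<and> (\<forall>j. d $ j \<le> c $ j \<longrightarrow> j \<le> i)"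
    using Max_eq_iff[OF _ ne, of i] by auto
  also have "\<dots> \<longleftrightarrow> d $ i \<le> c $ i \<and> (\<forall>j>i. c $ j < d $ j)"
    by (meson not_le)
  finally show ?thesis using True by (simp add: mac_Ii_def)
qed (simp add: mac_Ii_def)

lemma mac_index_eq: "c \<in> mac_I d \<Longrightarrow> mac_index d c = Max {i. d $ i \<le> c $ i}"
  unfolding mac_index_def by (simp add: mac_Ii_iff)

lemma ce_index_mac_index:
  "c \<in> mac_I d \<Longrightarrow> ce_index \<Delta> \<rho> \<delta> (dehomogenize c) = mac_index d c"
  by (simp add: ce_index_eq mac_index_eq)

lemma mac_index_mac_Ii: "c \<in> mac_I d \<Longrightarrow> c \<in> mac_Ii d (mac_index d c)"
  by (simp add: mac_Ii_iff mac_index_eq)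

lemma ce_exponent:
  assumes "c \<in> mac_I d"
  shows "dehomogenize c - ce_point \<Delta> \<rho> \<delta> (dehomogenize c) =
    dehomogenize (c - axis (mac_index d c) (d $ mac_index d c))"
proof -
  have "d $ mac_index d c \<le> c $ mac_index d c"
    using mac_index_mac_Ii[OF assms] by (simp add: mac_Ii_def)
  then show ?thesis
    using ce_point_eq[OF assms refl] by (simp add: dehomogenize_diff_axis ce_index_mac_index assms)
qed

text \<open>Both bases assign the same index \<open>i\<close> to the row, and \<open>a(b) = d\<^sub>i e\<^sub>i\<close> is the dehomogenization
  of the exponent \<open>d\<^sub>i\<close> at \<open>t\<^sub>i\<close> that is subtracted from \<open>c\<close>.\<close>

lemma pi_star_source_basis:
  assumes "c \<in> mac_I d"
  shows "pi_star_sum (mac_source_basis d c) = ce_source_basis \<Delta> \<rho> \<delta> (dehomogenize c)"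
  unfolding mac_source_basis_def ce_source_basis_def Let_def pi_star_sum_def in_summand_def
    ce_exponent[OF assms] ce_index_mac_index[OF assms]
  by (simp add: fun_eq_iff pi_star_monomial pi_star_0)

section \<open>Mixed cells\<close>

text \<open>A segment is not a single point, so in a \<open>k\<close>-mixed cell only \<open>C\<^sub>k\<close> can be a vertex.
  Conversely, if \<open>C\<^sub>k\<close> is the only component of dimension \<open>0\<close>, then the other \<open>n\<close> components have
  dimension at least \<open>1\<close>, and tightness leaves a total of \<open>n\<close>, so all of them have dimension \<open>1\<close>.\<close>

lemma mixed_cell_iff:
  assumes c: "c \<in> mac_I d" and C: "C \<in> ncells \<Delta> \<rho>" "unshifted c \<in> C"
  shows "(\<exists>k. mixed_cell \<Delta> \<rho> k C) \<longleftrightarrow> (\<exists>!i. d $ i \<le> c $ i)"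
proof
  note comp = component_at_unshifted[OF c C]
  assume "\<exists>k. mixed_cell \<Delta> \<rho> k C"
  then obtain k where k: "\<And>i. i \<noteq> k \<Longrightarrow> is_segment (component \<Delta> \<rho> C i)"
    by (auto simp: mixed_cell_def)
  have "i = k" if "d $ i \<le> c $ i" for i
  proof (rule ccontr)
    assume "i \<noteq> k"
    then obtain a b where ab: "a \<noteq> b" "component \<Delta> \<rho> C i = closed_segment a b"
      using k[OF \<open>i \<noteq> k\<close>] unfolding is_segment_def by blast
    then have "closed_segment a b = {corner (d $ i) i}"
      using comp(1)[OF that] by simp
    then show False using ab(1) by (metis ends_in_segment singletonD)
  qed
  then show "\<exists>!i. d $ i \<le> c $ i" using mac_I_exceeds[OF d_pos c] by metis
next
  note comp = component_at_unshifted[OF c C]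
  assume "\<exists>!i. d $ i \<le> c $ i"
  then obtain k where k: "d $ k \<le> c $ k" "\<And>i. i \<noteq> k \<Longrightarrow> c $ i < d $ i"
    by (metis not_le)
  let ?dim = "\<lambda>i. aff_dim (component \<Delta> \<rho> C i)"
  have ge: "1 \<le> ?dim i" if "i \<noteq> k" for i using comp(2) k(2)[OF that] by simp
  have "?dim k = 0" using comp(1)[OF k(1)] by simp
  then have total: "(\<Sum>i\<in>UNIV - {k}. ?dim i) = int (card (UNIV - {k}))"
  proof -
    have "(\<Sum>i\<in>UNIV. ?dim i) = int (ndim TYPE('i))"
      using tight C(1) unfolding tight_subdiv_def by blast
    moreover have "ndim TYPE('i) = card (UNIV - {k})"
      by (simp add: ndim_def)
    moreover have "(\<Sum>i\<in>UNIV. ?dim i) = ?dim k + (\<Sum>i\<in>UNIV - {k}. ?dim i)"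
      by (rule sum.remove) auto
    ultimately show ?thesis using \<open>?dim k = 0\<close> by linarith
  qed
  have "is_segment (component \<Delta> \<rho> C i)" if i: "i \<noteq> k" for i
  proof -
    have "int (card (UNIV - {k} - {i})) \<le> (\<Sum>j\<in>UNIV - {k} - {i}. ?dim j)"
      using sum_bounded_below[of "UNIV - {k} - {i}" 1 ?dim] ge by simp
    moreover have "(\<Sum>j\<in>UNIV - {k}. ?dim j) = ?dim i + (\<Sum>j\<in>UNIV - {k} - {i}. ?dim j)"
      using i by (intro sum.remove) auto
    moreover have "card (UNIV - {k}) = Suc (card (UNIV - {k} - {i}))"
      using i by (intro card.remove) auto
    ultimately have le1: "?dim i \<le> 1" using total by linarith
    obtain v where v: "component \<Delta> \<rho> C i = cell (\<Delta> i) (\<rho> i) v"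
      using C(1) by (rule ncellE) blast
    have cell: "cell (\<Delta> i) (\<rho> i) v =
        (\<Delta> i) \<inter> (\<Inter>y\<in>\<Delta> i. {x. \<rho> i x + v \<bullet> x \<le> \<rho> i y + v \<bullet> y})"
      by (auto simp: cell_def)
    have "compact (component \<Delta> \<rho> C i)"
      unfolding v cell
      by (intro compact_Int_closed compact_polytope_D closed_INT ballI closed_Collect_le
          continuous_intros continuous_on_rho)
    moreover have "convex (component \<Delta> \<rho> C i)"
      unfolding v convex_def
    proof (intro ballI allI impI)
      fix x y and a b :: real
      assume xy: "x \<in> cell (\<Delta> i) (\<rho> i) v" "y \<in> cell (\<Delta> i) (\<rho> i) v"
        and ab: "0 \<le> a" "0 \<le> b" "a + b = 1"
      have "\<rho> i (a *\<^sub>R x + b *\<^sub>R y) + v \<bullet> (a *\<^sub>R x + b *\<^sub>R y) \<le> \<rho> i z + v \<bullet> z"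
        if z: "z \<in> \<Delta> i" for z
      proof -
        have "\<rho> i (a *\<^sub>R x + b *\<^sub>R y) + v \<bullet> (a *\<^sub>R x + b *\<^sub>R y) =
            a * (\<rho> i x + v \<bullet> x) + b * (\<rho> i y + v \<bullet> y)"
          by (simp add: rho_affine[OF ab(3)] inner_add_right distrib_left)
        also have "\<dots> \<le> \<rho> i z + v \<bullet> z"
          using xy z ab by (intro convex_bound_le) (auto simp: cell_def)
        finally show ?thesis .
      qed
      moreover have "a *\<^sub>R x + b *\<^sub>R y \<in> \<Delta> i"
        using xy ab convex_polytope_D[of i] by (auto simp: cell_def convex_def)
      ultimately show "a *\<^sub>R x + b *\<^sub>R y \<in> cell (\<Delta> i) (\<rho> i) v" by (simp add: cell_def)
    qed
    moreover have "component \<Delta> \<rho> C i \<noteq> {}" using ge[OF i] by (auto simp: aff_dim_empty)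
    moreover have "collinear (component \<Delta> \<rho> C i)" using le1 by (simp add: collinear_aff_dim)
    ultimately obtain a b where ab: "component \<Delta> \<rho> C i = closed_segment a b"
      using compact_convex_collinear_segment by metis
    moreover have "a \<noteq> b" using ge[OF i] unfolding ab by auto
    ultimately show ?thesis by (auto simp: is_segment_def)
  qed
  then show "\<exists>k. mixed_cell \<Delta> \<rho> k C" by (auto simp: mixed_cell_def)
qed

lemma ce_Bcirc_iff:
  assumes c: "c \<in> mac_I d"
  shows "dehomogenize c \<in> ce_Bcirc \<Delta> \<rho> \<delta> \<longleftrightarrow> c \<in> mac_Icirc d"
proof -
  have mem: "rvec_of (dehomogenize c) \<in> (+) \<delta> ` C \<longleftrightarrow> unshifted c \<in> C" for C
    by (auto simp: unshifted_def image_iff) (metis add_diff_cancel_left' diff_add_cancel add.commute)+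
  have "dehomogenize c \<in> ce_B \<Delta> \<delta>"
    using bij_betw_apply[OF bij_betw_mac_I_ce_B c] .
  moreover have "(\<exists>C\<in>ncells \<Delta> \<rho>. unshifted c \<in> C \<and> (\<forall>k. \<not> mixed_cell \<Delta> \<rho> k C)) \<longleftrightarrow>
      \<not> (\<exists>!i. d $ i \<le> c $ i)"
    using mixed_cell_iff[OF c] ce_cell_at[OF c] by blast
  ultimately show ?thesis
    using c unfolding ce_Bcirc_def mac_Icirc_def mem mem_Collect_eq Diff_iff by blast
qed

lemma bij_betw_mac_Icirc_ce_Bcirc: "bij_betw dehomogenize (mac_Icirc d) (ce_Bcirc \<Delta> \<rho> \<delta>)"
proof (rule bij_betw_subset[OF bij_betw_mac_I_ce_B])
  show "mac_Icirc d \<subseteq> mac_I d" by (auto simp: mac_Icirc_def)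
  have "ce_Bcirc \<Delta> \<rho> \<delta> \<subseteq> dehomogenize ` mac_I d"
    using bij_betw_imp_surj_on[OF bij_betw_mac_I_ce_B] by (auto simp: ce_Bcirc_def)
  then show "dehomogenize ` mac_Icirc d = ce_Bcirc \<Delta> \<rho> \<delta>"
    using ce_Bcirc_iff by (auto simp: mac_Icirc_def)
qed

end


section \<open>Monomial spans and their images\<close>

lemma pi_star_eq_sum_superset:
  assumes "finite S" "Poly_Mapping.keys Q \<subseteq> S"
  shows "pi_star Q = (\<Sum>c\<in>S. Poly_Mapping.single (dehomogenize c) (Poly_Mapping.lookup Q c))"
  unfolding pi_star_eq_sum using assms
  by (intro sum.mono_neutral_left) (auto simp: in_keys_iff)

text \<open>The summands \<open>T\<^sub>i\<close> and \<open>T\<close> are given by conditions on the support, and \<open>V\<^sub>i\<close> and \<open>V\<close> as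
  spans of monomials; this passes from one description to the other.\<close>

lemma pi_star_image_supported:
  assumes S: "finite S" and K: "0 \<in> K"
  shows "pi_star ` {Q. (\<forall>c. Poly_Mapping.lookup Q c \<in> K) \<and> Poly_Mapping.keys Q \<subseteq> S} =
    mono_span K S dehomogenize"
proof (intro equalityI subsetI)
  fix G assume "G \<in> pi_star ` {Q. (\<forall>c. Poly_Mapping.lookup Q c \<in> K) \<and> Poly_Mapping.keys Q \<subseteq> S}"
  then obtain Q where "G = pi_star Q" "\<forall>c. Poly_Mapping.lookup Q c \<in> K" "Poly_Mapping.keys Q \<subseteq> S"
    by blast
  then show "G \<in> mono_span K S dehomogenize"
    unfolding mono_span_def using pi_star_eq_sum_superset[OF S]
    by (auto intro!: exI[of _ "Poly_Mapping.lookup Q"])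
next
  fix G assume "G \<in> mono_span K S dehomogenize"
  then obtain k where k: "\<forall>c\<in>S. k c \<in> K"
    "G = (\<Sum>c\<in>S. Poly_Mapping.single (dehomogenize c) (k c))"
    unfolding mono_span_def by blast
  define Q where "Q = (\<Sum>c\<in>S. Poly_Mapping.single c (k c))"
  have lookup: "Poly_Mapping.lookup Q c = (if c \<in> S then k c else 0)" for c
    using S by (simp add: Q_def lookup_sum lookup_single when_def)
  have "G = pi_star Q"
    by (simp add: k(2) Q_def pi_star_sum_of pi_star_monomial)
  moreover have "\<forall>c. Poly_Mapping.lookup Q c \<in> K"
    using k(1) K by (simp add: lookup)
  moreover have "Poly_Mapping.keys Q \<subseteq> S"
    by (auto simp: in_keys_iff lookup split: if_splits)
  ultimately show "G \<in> pi_star ` {Q. (\<forall>c. Poly_Mapping.lookup Q c \<in> K) \<and> Poly_Mapping.keys Q \<subseteq> S}"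
    by blast
qed

lemma mono_span_image:
  assumes f: "inj_on f X" and e: "\<And>x. x \<in> X \<Longrightarrow> e (f x) = g x"
  shows "mono_span K (f ` X) e = mono_span K X g"
proof (intro equalityI subsetI)
  have sum_eq: "(\<Sum>y\<in>f ` X. Poly_Mapping.single (e y) (k y)) = (\<Sum>x\<in>X. Poly_Mapping.single (g x) (k (f x)))"
    for k
    using e by (simp add: sum.reindex[OF f])
  show "G \<in> mono_span K X g" if G: "G \<in> mono_span K (f ` X) e" for G
  proof -
    obtain k where "\<forall>y\<in>f ` X. k y \<in> K" "G = (\<Sum>y\<in>f ` X. Poly_Mapping.single (e y) (k y))"
      using G unfolding mono_span_def by blast
    then show ?thesis unfolding sum_eq mono_span_def by (auto intro!: exI[of _ "\<lambda>x. k (f x)"])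
  qed
  show "G \<in> mono_span K (f ` X) e" if G: "G \<in> mono_span K X g" for G
  proof -
    obtain k where k: "\<forall>x\<in>X. k x \<in> K" "G = (\<Sum>x\<in>X. Poly_Mapping.single (g x) (k x))"
      using G unfolding mono_span_def by blast
    define k' where "k' = (\<lambda>y. k (inv_into X f y))"
    have k': "k' (f x) = k x" if "x \<in> X" for x
      using that f by (simp add: k'_def)
    have "G = (\<Sum>y\<in>f ` X. Poly_Mapping.single (e y) (k' y))"
      unfolding sum_eq k(2) by (simp add: k')
    moreover have "\<forall>y\<in>f ` X. k' y \<in> K"
      using k(1) k' by simp
    ultimately show ?thesis unfolding mono_span_def by blast
  qed
qed

lemma single_one_eq_iff:
  "Poly_Mapping.single a (1 :: 'k::zero_neq_one) = Poly_Mapping.single b 1 \<longleftrightarrow> a = b"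
  by (metis lookup_single_eq lookup_single_not_eq one_neq_zero)

lemma in_summand_monomial_eq_iff:
  fixes a b :: 'x
  shows "in_summand i (Poly_Mapping.single a (1 :: 'k::zero_neq_one)) =
    in_summand j (Poly_Mapping.single b 1) \<longleftrightarrow> i = j \<and> a = b"
proof
  assume eq: "in_summand i (Poly_Mapping.single a (1 :: 'k)) = in_summand j (Poly_Mapping.single b 1)"
  have "Poly_Mapping.single a (1 :: 'k) \<noteq> 0"
    by (metis lookup_single_eq lookup_zero one_neq_zero)
  then have "i = j \<and> Poly_Mapping.single a (1 :: 'k) = Poly_Mapping.single b 1"
    using fun_cong[OF eq, of i] by (auto simp: in_summand_def split: if_splits)
  then show "i = j \<and> a = b" by (simp add: single_one_eq_iff)
qed simp

text \<open>The exponent of the basis monomial of \<open>T\<^sub>i\<close> indexed by \<open>c\<close>.\<close>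

definition lower_exponent :: "'i nvec \<Rightarrow> 'i \<Rightarrow> 'i nvec \<Rightarrow> 'i::{finite,linorder} nvec" where
  "lower_exponent d i c = c - axis i (d $ i)"

lemma lower_exponent_add:
  "d $ i \<le> c $ i \<Longrightarrow> lower_exponent d i c + axis i (d $ i) = c"
  by (auto simp: vec_eq_iff lower_exponent_def axis_def)

lemma lower_exponent_of_add: "lower_exponent d i (e + axis i (d $ i)) = e"
  by (auto simp: vec_eq_iff lower_exponent_def axis_def)

lemma inj_on_lower_exponent: "inj_on (lower_exponent d i) (mac_Ii d i)"
  by (rule inj_on_inverseI[of _ "\<lambda>e. e + axis i (d $ i)"]) (simp add: lower_exponent_add mac_Ii_def)

lemma vsum_lower_exponent:
  assumes "c \<in> mac_Ii d i"
  shows "vsum (lower_exponent d i c) = mac_deg d - d $ i"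
proof -
  have "vsum (lower_exponent d i c) + d $ i = vsum (lower_exponent d i c + axis i (d $ i))"
    by (simp add: vsum_add)
  also have "\<dots> = mac_deg d"
    using assms by (subst lower_exponent_add) (auto simp: mac_Ii_def mac_I_def)
  finally show ?thesis by simp
qed

lemma mac_T_supported:
  "mac_T d = {Q. (\<forall>c. Poly_Mapping.lookup Q c \<in> Kfield d) \<and> Poly_Mapping.keys Q \<subseteq> mac_I d}"
  by (auto simp: mac_T_def homog_part_def mac_I_def)

lemma mac_Ti_supported:
  assumes d: "\<And>i. 0 < d $ i"
  shows "mac_Ti d i = {Q. (\<forall>c. Poly_Mapping.lookup Q c \<in> Kfield d) \<and>
    Poly_Mapping.keys Q \<subseteq> lower_exponent d i ` mac_Ii d i}"
proof -
  have "vsum e = mac_deg d - d $ i \<and> (\<forall>j>i. e $ j < d $ j) \<longleftrightarrow> e \<in> lower_exponent d i ` mac_Ii d i" for e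
  proof
    assume e: "vsum e = mac_deg d - d $ i \<and> (\<forall>j>i. e $ j < d $ j)"
    then have "vsum (e + axis i (d $ i)) = mac_deg d"
      using degree_le_mac_deg[of d i, OF d] by (simp add: vsum_add)
    moreover have "(e + axis i (d $ i)) $ j = e $ j" if "i < j" for j
      using that by (auto simp: axis_def)
    ultimately have "e + axis i (d $ i) \<in> mac_Ii d i"
      using e by (auto simp: mac_Ii_def mac_I_def axis_def)
    then show "e \<in> lower_exponent d i ` mac_Ii d i"
      by (metis image_eqI lower_exponent_of_add)
  next
    assume "e \<in> lower_exponent d i ` mac_Ii d i"
    then obtain c where c: "c \<in> mac_Ii d i" "e = lower_exponent d i c" by blast
    moreover have "lower_exponent d i c $ j = c $ j" if "i < j" for j
      using that by (auto simp: lower_exponent_def axis_def)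
    ultimately show "vsum e = mac_deg d - d $ i \<and> (\<forall>j>i. e $ j < d $ j)"
      using vsum_lower_exponent[OF c(1)] by (auto simp: mac_Ii_def)
  qed
  then show ?thesis
    unfolding mac_Ti_def homog_part_def deg_in_less_iff[OF d] by blast
qed

lemma finite_mac_I: "finite (mac_I d)"
  unfolding mac_I_def by (rule finite_vsum_eq)

lemma finite_mac_Ii: "finite (mac_Ii d i)"
  by (rule finite_subset[OF _ finite_mac_I[of d]]) (auto simp: mac_Ii_def)

lemma mac_Psi_in_mac_T:
  assumes d: "\<And>i. 0 < d $ i" and Q: "Q \<in> direct_sum (mac_Ti d)"
  shows "mac_Psi d Q \<in> mac_T d"
  unfolding mac_Psi_def mac_T_def
proof (rule homog_part_sum)
  fix i
  have "Q i \<in> homog_part d (mac_deg d - d $ i)"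
    using Q by (auto simp: direct_sum_def mac_Ti_def)
  from homog_part_mult[OF this mac_P_homog[of d i]] show "Q i * mac_P d i \<in> homog_part d (mac_deg d)"
    using degree_le_mac_deg[of d i, OF d] by simp
qed

section \<open>The source and target spaces, bases and matrices\<close>

context macaulay_subdivision
begin

lemma ce_Bi_eq: "ce_Bi \<Delta> \<rho> \<delta> i = dehomogenize ` mac_Ii d i"
proof -
  have B: "ce_B \<Delta> \<delta> = dehomogenize ` mac_I d"
    using bij_betw_imp_surj_on[OF bij_betw_mac_I_ce_B] by simp
  show ?thesis
    unfolding ce_Bi_def B using ce_index_eq mac_Ii_iff by (auto simp: image_iff)
qed

lemma pi_star_image_mac_T: "pi_star ` mac_T d = ce_V (Kfield d) \<Delta> \<delta>"
proof -
  have "ce_V (Kfield d) \<Delta> \<delta> = mono_span (Kfield d) (dehomogenize ` mac_I d) (\<lambda>b. b)"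
    unfolding ce_V_def bij_betw_imp_surj_on[OF bij_betw_mac_I_ce_B] ..
  also have "\<dots> = mono_span (Kfield d) (mac_I d) dehomogenize"
    by (rule mono_span_image) (auto intro: bij_betw_imp_inj_on[OF bij_betw_mac_I_ce_B])
  also have "\<dots> = pi_star ` mac_T d"
    unfolding mac_T_supported by (rule pi_star_image_supported[symmetric]) (rule finite_mac_I Kfield_0)+
  finally show ?thesis ..
qed

lemma pi_star_image_mac_Ti: "pi_star ` mac_Ti d i = ce_Vi (Kfield d) \<Delta> \<rho> \<delta> i"
proof -
  have exps: "dehomogenize c - ce_point \<Delta> \<rho> \<delta> (dehomogenize c) = dehomogenize (lower_exponent d i c)"
    if "c \<in> mac_Ii d i" for c
    using that ce_exponent[of c] mac_index_eq[of c] by (simp add: mac_Ii_iff lower_exponent_def)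
  have "inj_on dehomogenize (mac_Ii d i)"
    using bij_betw_imp_inj_on[OF bij_betw_mac_I_ce_B]
    by (rule inj_on_subset) (auto simp: mac_Ii_def)
  then have "ce_Vi (Kfield d) \<Delta> \<rho> \<delta> i =
      mono_span (Kfield d) (mac_Ii d i) (\<lambda>c. dehomogenize (lower_exponent d i c))"
    unfolding ce_Vi_def ce_Bi_eq by (rule mono_span_image) (rule exps)
  also have "\<dots> = mono_span (Kfield d) (lower_exponent d i ` mac_Ii d i) dehomogenize"
    by (rule mono_span_image[symmetric]) (auto intro: inj_on_lower_exponent)
  also have "\<dots> = pi_star ` mac_Ti d i"
    unfolding mac_Ti_supported[OF d_pos]
    by (rule pi_star_image_supported[symmetric]) (rule finite_imageI finite_mac_Ii Kfield_0)+
  finally show ?thesis ..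
qed

lemma pi_star_sum_image_direct_sum:
  "pi_star_sum ` direct_sum (mac_Ti d) = direct_sum (ce_Vi (Kfield d) \<Delta> \<rho> \<delta>)"
proof (intro equalityI subsetI)
  fix G assume "G \<in> direct_sum (ce_Vi (Kfield d) \<Delta> \<rho> \<delta>)"
  then have "\<forall>i. \<exists>q. q \<in> mac_Ti d i \<and> G i = pi_star q"
    by (auto simp: direct_sum_def simp flip: pi_star_image_mac_Ti)
  then obtain Q where "\<forall>i. Q i \<in> mac_Ti d i \<and> G i = pi_star (Q i)" by metis
  then show "G \<in> pi_star_sum ` direct_sum (mac_Ti d)"
    by (auto simp: direct_sum_def pi_star_sum_def fun_eq_iff intro!: image_eqI[of _ _ Q])
qed (auto simp: direct_sum_def pi_star_sum_def simp flip: pi_star_image_mac_Ti)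

lemma mac_source_basis_eq:
  "mac_source_basis d c =
    in_summand (mac_index d c) (Poly_Mapping.single (lower_exponent d (mac_index d c) c) 1)"
  by (simp add: mac_source_basis_def Let_def lower_exponent_def)

lemma mac_source_basis_in:
  assumes "c \<in> mac_I d"
  shows "mac_source_basis d c \<in> direct_sum (mac_Ti d)"
  using mac_index_mac_Ii[OF assms]
  by (auto simp: mac_source_basis_eq direct_sum_def in_summand_def mac_Ti_supported[OF d_pos]
      lookup_single when_def Kfield_0 Kfield_1)

lemma ce_source_basis_eq:
  assumes "c \<in> mac_I d"
  shows "ce_source_basis \<Delta> \<rho> \<delta> (dehomogenize c) =
    in_summand (mac_index d c) (Poly_Mapping.single (dehomogenize (lower_exponent d (mac_index d c) c)) 1)"
  unfolding ce_source_basis_def ce_exponent[OF assms] ce_index_mac_index[OF assms]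
  by (simp add: lower_exponent_def)

lemma bij_betw_source_bases:
  "bij_betw pi_star_sum (mac_source_basis d ` mac_I d) (ce_source_basis \<Delta> \<rho> \<delta> ` ce_B \<Delta> \<delta>)"
  unfolding bij_betw_def
proof
  show "inj_on pi_star_sum (mac_source_basis d ` mac_I d)"
  proof (rule inj_onI, clarify)
    fix c c' assume c: "c \<in> mac_I d" "c' \<in> mac_I d"
      and eq: "pi_star_sum (mac_source_basis d c) = pi_star_sum (mac_source_basis d c')"
    let ?l = "\<lambda>c. lower_exponent d (mac_index d c) c"
    have same: "mac_index d c = mac_index d c' \<and> dehomogenize (?l c) = dehomogenize (?l c')"
      using eq unfolding pi_star_source_basis[OF c(1)] pi_star_source_basis[OF c(2)]
        ce_source_basis_eq[OF c(1)] ce_source_basis_eq[OF c(2)]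
      by (rule in_summand_monomial_eq_iff[THEN iffD1])
    moreover have "?l c = ?l c'"
    proof (rule dehomogenize_inj)
      show "dehomogenize (?l c) = dehomogenize (?l c')" using same by (rule conjunct2)
      show "vsum (?l c) = vsum (?l c')"
        using vsum_lower_exponent[OF mac_index_mac_Ii[OF c(1)]]
          vsum_lower_exponent[OF mac_index_mac_Ii[OF c(2)]] same[THEN conjunct1] by simp
    qed
    ultimately show "mac_source_basis d c = mac_source_basis d c'"
      by (simp add: mac_source_basis_eq)
  qed
  show "pi_star_sum ` mac_source_basis d ` mac_I d = ce_source_basis \<Delta> \<rho> \<delta> ` ce_B \<Delta> \<delta>"
    unfolding bij_betw_imp_surj_on[OF bij_betw_mac_I_ce_B, symmetric] image_image
    by (intro image_cong refl pi_star_source_basis)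
qed

lemma pi_star_target_basis: "pi_star (mac_target_basis c) = ce_target_basis (dehomogenize c)"
  by (simp add: mac_target_basis_def ce_target_basis_def pi_star_monomial)

lemma bij_betw_target_bases:
  "bij_betw pi_star (mac_target_basis ` mac_I d) (ce_target_basis ` ce_B \<Delta> \<delta>)"
  unfolding bij_betw_def
proof
  show "inj_on pi_star (mac_target_basis ` mac_I d)"
    by (auto intro!: inj_onI dehomogenize_inj arg_cong[where f = mac_target_basis]
        simp: pi_star_target_basis ce_target_basis_def single_one_eq_iff mac_I_def)
  show "pi_star ` mac_target_basis ` mac_I d = ce_target_basis ` ce_B \<Delta> \<delta>"
    unfolding bij_betw_imp_surj_on[OF bij_betw_mac_I_ce_B, symmetric] image_image
    by (intro image_cong refl pi_star_target_basis)
qed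

lemma ce_H_eq_mac_M:
  assumes c: "c \<in> mac_I d" and c': "c' \<in> mac_I d"
  shows "ce_H (gen_F d) \<Delta> \<rho> \<delta> (dehomogenize c) (dehomogenize c') = mac_M d c c'"
proof -
  have "mac_Psi d (mac_source_basis d c) \<in> mac_T d"
    by (rule mac_Psi_in_mac_T[OF d_pos mac_source_basis_in[OF c]])
  then have "Poly_Mapping.lookup (pi_star (mac_Psi d (mac_source_basis d c))) (dehomogenize c') =
      Poly_Mapping.lookup (mac_Psi d (mac_source_basis d c)) c'"
    using c' by (intro lookup_pi_star) (auto simp: mac_T_supported mac_I_def)
  then show ?thesis
    using c c' bij_betw_apply[OF bij_betw_mac_I_ce_B]
    by (simp add: ce_H_def mac_M_def row_matrix_def pi_star_mac_Psi pi_star_source_basis)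
qed

lemma ce_E_eq_mac_N:
  assumes "c \<in> mac_Icirc d" "c' \<in> mac_Icirc d"
  shows "ce_E (gen_F d) \<Delta> \<rho> \<delta> (dehomogenize c) (dehomogenize c') = mac_N d c c'"
proof -
  have "c \<in> mac_I d" "c' \<in> mac_I d" using assms by (auto simp: mac_Icirc_def)
  then show ?thesis
    using assms bij_betw_apply[OF bij_betw_mac_Icirc_ce_Bcirc]
    by (simp add: ce_E_def mac_N_def principal_submatrix_def ce_H_eq_mac_M)
qed

end

theorem proposition5p9:
  fixes d :: "'i::{finite,linorder} nvec"
    and \<mu> \<rho> :: "'i \<Rightarrow> 'i rvec \<Rightarrow> real"
    and \<delta> :: "'i rvec"
    and \<Delta> :: "'i \<Rightarrow> ('i rvec) set"
    and K :: "ufrac set"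
  assumes d_pos: "\<And>i. 0 < d $ i"
    and K_eq: "K = Kfield d"
    and Delta_eq: "\<Delta> = polytope_D d"
    and mu_linear: "\<And>i. linear (\<mu> i)"
    and rho_eq: "\<And>i x. \<rho> i x = phi d i x + \<mu> i x"
    and tight: "tight_subdiv \<Delta> \<rho>"
    and refines: "subdiv_refines \<Delta> \<rho> (phi d)"
    and delta_in: "\<delta> \<in> coords1n"
    and delta_pos: "\<And>i. i \<noteq> ix0 \<Longrightarrow> 0 < \<delta> $ i + 1"
    and delta_sum: "(\<Sum>i\<in>UNIV - {ix0}. (\<delta> $ i + 1)) < 1"
    and generic: "generic_shift \<Delta> \<rho> \<delta>"
  shows
    "mac_Psi d ` direct_sum (mac_Ti d) \<subseteq> mac_T d \<and>
     ce_Phi (gen_F d) ` direct_sum (ce_Vi K \<Delta> \<rho> \<delta>) \<subseteq> ce_V K \<Delta> \<delta> \<and>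
     pi_star_sum ` direct_sum (mac_Ti d) \<subseteq> direct_sum (ce_Vi K \<Delta> \<rho> \<delta>) \<and>
     pi_star ` mac_T d \<subseteq> ce_V K \<Delta> \<delta> \<and>
     (\<forall>Q\<in>direct_sum (mac_Ti d).
        pi_star (mac_Psi d Q) = ce_Phi (gen_F d) (pi_star_sum Q)) \<and>
     bij_betw pi_star_sum
       (mac_source_basis d ` mac_I d) (ce_source_basis \<Delta> \<rho> \<delta> ` ce_B \<Delta> \<delta>) \<and>
     bij_betw pi_star (mac_target_basis ` mac_I d) (ce_target_basis ` ce_B \<Delta> \<delta>) \<and>
     (\<exists>\<beta>. bij_betw \<beta> (mac_I d) (ce_B \<Delta> \<delta>) \<and>
        (\<forall>c\<in>mac_I d. pi_star_sum (mac_source_basis d c) = ce_source_basis \<Delta> \<rho> \<delta> (\<beta> c)) \<and>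
        (\<forall>c\<in>mac_I d. pi_star (mac_target_basis c) = ce_target_basis (\<beta> c)) \<and>
        (\<forall>c\<in>mac_I d. \<forall>c'\<in>mac_I d. ce_H (gen_F d) \<Delta> \<rho> \<delta> (\<beta> c) (\<beta> c') = mac_M d c c') \<and>
        bij_betw \<beta> (mac_Icirc d) (ce_Bcirc \<Delta> \<rho> \<delta>) \<and>
        (\<forall>c\<in>mac_Icirc d. \<forall>c'\<in>mac_Icirc d.
           ce_E (gen_F d) \<Delta> \<rho> \<delta> (\<beta> c) (\<beta> c') = mac_N d c c'))"
proof -
  interpret macaulay_subdivision d \<mu> \<rho> \<delta>
    by (rule macaulay_subdivision.intro[OF d_pos mu_linear rho_eq tight[unfolded Delta_eq]
          refines[unfolded Delta_eq] delta_in delta_pos delta_sum generic[unfolded Delta_eq]])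
  have Phi: "ce_Phi (gen_F d) G \<in> ce_V (Kfield d) (polytope_D d) \<delta>"
    if G: "G \<in> direct_sum (ce_Vi (Kfield d) (polytope_D d) \<rho> \<delta>)" for G
  proof -
    obtain Q where Q: "Q \<in> direct_sum (mac_Ti d)" "G = pi_star_sum Q"
      using G unfolding pi_star_sum_image_direct_sum[symmetric] by blast
    then show ?thesis
      using mac_Psi_in_mac_T[OF d_pos Q(1)]
      by (auto simp flip: pi_star_mac_Psi pi_star_image_mac_T)
  qed
  show ?thesis
    unfolding K_eq Delta_eq
  proof (intro conjI exI[of _ dehomogenize] ballI)
    show "mac_Psi d ` direct_sum (mac_Ti d) \<subseteq> mac_T d"
      using mac_Psi_in_mac_T[OF d_pos] by blast
    show "ce_Phi (gen_F d) ` direct_sum (ce_Vi (Kfield d) (polytope_D d) \<rho> \<delta>)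
        \<subseteq> ce_V (Kfield d) (polytope_D d) \<delta>"
      using Phi by blast
  qed (simp_all add: pi_star_sum_image_direct_sum pi_star_image_mac_T pi_star_mac_Psi
      bij_betw_source_bases bij_betw_target_bases bij_betw_mac_I_ce_B pi_star_source_basis
      pi_star_target_basis ce_H_eq_mac_M bij_betw_mac_Icirc_ce_Bcirc ce_E_eq_mac_N)
qed

end
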